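(* Let $\alpha>-1$, $\gamma>-1$, $\delta>0$, $\rho>0$, $a>0$, $b>0$, $\beta>0$, and for $x\ge 0$ let $$f_1(x)=\frac{\delta\, a^{\frac{\alpha+1}{\delta}}\Gamma(\frac{\alpha+1}{\delta}+\beta)}{\Gamma(\frac{\alpha+1}{\delta})\Gamma(\beta)}x^{\alpha}(1+ax^{\delta})^{-(\frac{\alpha+1}{\delta}+\beta)},\qquad f_2(x)=\frac{\rho\, b^{\frac{\gamma+1}{\rho}}}{\Gamma(\frac{\gamma+1}{\rho})}x^{\gamma}e^{-bx^{\rho}},$$ both zero elsewhere. Let $g_2(u)=\int_0^\infty v f_1(v)f_2(uv)\,dv$, and let $$c=\frac{\delta\rho\, a^{\frac{\alpha+1}{\delta}}b^{\frac{\gamma+1}{\rho}}\Gamma(\frac{\alpha+1}{\delta}+\beta)}{\Gamma(\frac{\alpha+1}{\delta})\Gamma(\beta)\Gamma(\frac{\gamma+1}{\rho})},\qquad c_1=\frac{b^{\frac{1}{\rho}}}{a^{\frac{1}{\delta}}\Gamma(\frac{\alpha+1}{\delta})\Gamma(\beta)\Gamma(\frac{\gamma+1}{\rho})}.$$ Then for $0\le u<\infty$ $$g_2(u)=c\,u^{-\alpha-2}\int_0^{\infty}v^{\alpha+\gamma+1}\left[1+a\left(\tfrac{v}{u}\right)^{\delta}\right]^{-(\frac{\alpha+1}{\delta}+\beta)}e^{-bv^{\rho}}\,dv$$ $$=c\,u^{\gamma}\int_0^{\infty}v^{\alpha+\gamma+1}[1+av^{\delta}]^{-(\frac{\alpha+1}{\delta}+\beta)}e^{-b(uv)^{\rho}}\,dv$$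 $$=c_1\,H^{2,1}_{1,2}\left[\frac{b^{1/\rho}u}{a^{1/\delta}}\,\Big|\,{(1-\frac{2+\alpha}{\delta},\frac{1}{\delta})\atop (\frac{\gamma}{\rho},\frac{1}{\rho}),\ (\beta-\frac{1}{\delta},\frac{1}{\delta})}\right].$$ Moreover, if $\rho=\delta$ and $\gamma-\delta\beta+1\ne\pm\nu$ for all $\nu=0,1,\dots$, then for $0\le u<\infty$ $$H^{2,1}_{1,2}\left[\left(\tfrac{b}{a}\right)^{\frac1\delta}u\,\Big|\,{(1-\frac{2+\alpha}{\delta},\frac{1}{\delta})\atop (\frac{\gamma}{\delta},\frac{1}{\delta}),\ (\beta-\frac{1}{\delta},\frac{1}{\delta})}\right]$$ $$=\delta\,\Gamma\left(\beta-\tfrac{\gamma+1}{\delta}\right)\Gamma\left(\tfrac{2+\alpha+\gamma}{\delta}\right)\left[\left(\tfrac ba\right)^{\frac1\delta}u\right]^{\gamma}{}_1F_1\left(\tfrac{2+\alpha+\gamma}{\delta};1+\tfrac{\gamma+1}{\delta}-\beta;\tfrac{b}{a}u^{\delta}\right)$$ $$+\delta\,\Gamma\left(\tfrac{\gamma+1}{\delta}-\beta\right)\Gamma\left(\tfrac{\alpha+1}{\delta}+\beta\right)\left[\left(\tfrac ba\right)^{\frac1\delta}u\right]^{\beta\delta-1}{}_1F_1\left(\tfrac{\alpha+1}{\delta}+\beta;1+\beta-\tfrac{\gamma+1}{\delta};\tfrac{b}{a}u^{\delta}\right).$$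
   Context: H-function (the case used here): $$H^{2,1}_{1,2}\left[z\,\Big|\,{(a_1,A_1)\atop (b_1,B_1),(b_2,B_2)}\right]=\frac{1}{2\pi i}\int_{\kappa-i\infty}^{\kappa+i\infty}\Gamma(b_1+B_1s)\Gamma(b_2+B_2s)\Gamma(1-a_1-A_1s)\,z^{-s}\,ds,$$ where $A_1,B_1,B_2>0$ and the real number $\kappa$ is such that all poles of $\Gamma(b_1+B_1s)$ and $\Gamma(b_2+B_2s)$ lie to the left and all poles of $\Gamma(1-a_1-A_1s)$ lie to the right of the line $\Re s=\kappa$. In the present case the integrand is $\Gamma(\frac{\gamma+s}{\rho})\Gamma(\beta-\frac1\delta+\frac s\delta)\Gamma(\frac{2+\alpha-s}{\delta})\left(\frac{b^{1/\rho}u}{a^{1/\delta}}\right)^{-s}$ with $\max(-\gamma,1-\beta\delta)<\kappa<2+\alpha$. ${}_1F_1$ is the confluent hypergeometric series. The function $g_2$ is the Mellin convolution of a ratio of $f_1$ and $f_2$ (the density of $u=x_2/x_1$ for independent positive random variables $x_1,x_2$ with densities $f_1,f_2$).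
   Formalization: The exceptional values are corrected to γ−δβ+1 ≠ ±δν (with ±ν the right side can be undefined, e.g. δ=1/2, γ=0, β=1); at u=0, where v/u and H are undefined, all sides are read as 0 by convention (also 0^0=0 when γ=0). *)

theory Defs
  imports "HOL-Complex_Analysis.Complex_Analysis"
begin

text \<open>
  The line \<open>Re s = \<kappa>\<close> is an admissible contour for the H-function below if it has all poles of
  \<open>\<Gamma>(b\<^sub>1 + B\<^sub>1 s)\<close> and \<open>\<Gamma>(b\<^sub>2 + B\<^sub>2 s)\<close> on its left and all poles of \<open>\<Gamma>(1 - a\<^sub>1 - A\<^sub>1 s)\<close> on
  its right.
\<close>

definition H_separating :: "real \<Rightarrow> real \<Rightarrow> real \<Rightarrow> real \<Rightarrow> real \<Rightarrow> real \<Rightarrow> real \<Rightarrow> bool" where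
  "H_separating \<kappa> a1 A1 b1 B1 b2 B2 \<longleftrightarrow>
     (\<forall>s. is_pole (\<lambda>s. Gamma (of_real b1 + of_real B1 * s)) s \<longrightarrow> Re s < \<kappa>) \<and>
     (\<forall>s. is_pole (\<lambda>s. Gamma (of_real b2 + of_real B2 * s)) s \<longrightarrow> Re s < \<kappa>) \<and>
     (\<forall>s. is_pole (\<lambda>s. Gamma (1 - of_real a1 - of_real A1 * s)) s \<longrightarrow> \<kappa> < Re s)"

definition H_integrand :: "real \<Rightarrow> real \<Rightarrow> real \<Rightarrow> real \<Rightarrow> real \<Rightarrow> real \<Rightarrow> real \<Rightarrow> complex \<Rightarrow> complex" where
  "H_integrand a1 A1 b1 B1 b2 B2 z s =
     Gamma (of_real b1 + of_real B1 * s) * Gamma (of_real b2 + of_real B2 * s) *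
     Gamma (1 - of_real a1 - of_real A1 * s) * of_real z powr (- s)"

text \<open>
  The function \<open>H\<close> with upper indices \<open>2,1\<close> and lower indices \<open>1,2\<close>, evaluated along the line
  \<open>Re s = \<kappa>\<close>.  The line is parametrised by \<open>s = \<kappa> + i t\<close>, which accounts for the factor \<open>\<i>\<close>
  under the integral.  The abscissa is an argument of the constant; results about the H-function
  are to be stated for every \<open>\<kappa>\<close> with \<^const>\<open>H_separating\<close>.  At \<open>z = 0\<close>, where \<open>z\<^sup>-\<^sup>s\<close> is
  undefined, the convention \<open>0 powr w = 0\<close> makes the value \<open>0\<close>.
\<close>

definition H21_12 :: "real \<Rightarrow> real \<Rightarrow> real \<Rightarrow> real \<Rightarrow> real \<Rightarrow> real \<Rightarrow> real \<Rightarrow> real \<Rightarrow> complex" where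
  "H21_12 \<kappa> a1 A1 b1 B1 b2 B2 z =
     1 / (2 * of_real pi * \<i>) *
       (LBINT t. H_integrand a1 A1 b1 B1 b2 B2 z (Complex \<kappa> t) * \<i>)"

definition confluent_1F1 :: "real \<Rightarrow> real \<Rightarrow> real \<Rightarrow> real" where
  "confluent_1F1 a b z = eval_fps (fps_hypergeo [a] [b] 1) z"

lemma confluent_1F1_altdef:
  "confluent_1F1 a b z = (\<Sum>n. pochhammer a n / pochhammer b n * z ^ n / fact n)"
  by (simp add: confluent_1F1_def eval_fps_def)

lemma is_pole_Gamma_affine_iff:
  fixes b B :: real and s :: complex
  assumes "B \<noteq> 0"
  shows "is_pole (\<lambda>s. Gamma (of_real b + of_real B * s)) s \<longleftrightarrow>
         (\<exists>n::nat. s = of_real ((- b - n) / B))"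
proof
  assume pole: "is_pole (\<lambda>s. Gamma (of_real b + of_real B * s)) s"
  have "of_real b + of_real B * s \<in> (\<int>\<^sub>\<le>\<^sub>0 :: complex set)"
  proof (rule ccontr)
    assume *: "of_real b + of_real B * s \<notin> (\<int>\<^sub>\<le>\<^sub>0 :: complex set)"
    have "isCont (\<lambda>s. Gamma (of_real b + of_real B * s)) s"
      using * by (intro continuous_intros) auto
    thus False
      using pole unfolding is_pole_def isCont_def
      by (meson not_tendsto_and_filterlim_at_infinity at_neq_bot)
  qed
  then obtain n :: nat where "of_real b + of_real B * s = - (of_nat n :: complex)"
    by (elim nonpos_Ints_cases') auto
  hence "of_real B * s = of_real (- b - n)"
    by (metis (no_types) add_diff_cancel_left' minus_diff_commute of_real_diff of_real_minus
          of_real_of_nat_eq)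
  hence "s = of_real (- b - n) / of_real B"
    using assms by (metis nonzero_mult_div_cancel_left of_real_eq_0_iff)
  hence "s = of_real ((- b - n) / B)"
    by (simp only: of_real_divide)
  thus "\<exists>n::nat. s = of_real ((- b - n) / B)" ..
next
  assume "\<exists>n::nat. s = of_real ((- b - n) / B)"
  then obtain n :: nat where s: "s = of_real ((- b - n) / B)" ..
  have eq: "of_real b + of_real B * s = - (of_nat n :: complex)"
    using assms by (simp add: s)
  have lim: "filterlim (\<lambda>s. of_real b + of_real B * s) (at (- of_nat n :: complex)) (at s)"
    unfolding filterlim_at
  proof
    show "\<forall>\<^sub>F x in at s. of_real b + of_real B * x \<in> (UNIV :: complex set) \<and>
            of_real b + of_real B * x \<noteq> - of_nat n"
      using assms by (auto simp: eq [symmetric] eventually_at_filter)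
    show "((\<lambda>s. of_real b + of_real B * s) \<longlongrightarrow> - (of_nat n :: complex)) (at s)"
      unfolding eq [symmetric] by (intro tendsto_intros)
  qed
  show "is_pole (\<lambda>s. Gamma (of_real b + of_real B * s)) s"
    unfolding is_pole_def by (rule filterlim_compose [OF Gamma_poles lim])
qed

lemma H_separating_iff:
  assumes "A1 > 0" "B1 > 0" "B2 > 0"
  shows "H_separating \<kappa> a1 A1 b1 B1 b2 B2 \<longleftrightarrow>
           max (- b1 / B1) (- b2 / B2) < \<kappa> \<and> \<kappa> < (1 - a1) / A1"
proof -
  have left: "(\<forall>s. is_pole (\<lambda>s. Gamma (of_real b + of_real B * s)) s \<longrightarrow> Re s < \<kappa>) \<longleftrightarrow>
          - b / B < \<kappa>" if "B > 0" for b B :: real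
  proof -
    have "(\<forall>n::nat. (- b - n) / B < \<kappa>) \<longleftrightarrow> - b / B < \<kappa>"
    proof
      assume "\<forall>n::nat. (- b - n) / B < \<kappa>"
      thus "- b / B < \<kappa>" by (auto dest: spec [of _ 0])
    next
      assume *: "- b / B < \<kappa>"
      show "\<forall>n::nat. (- b - n) / B < \<kappa>"
      proof
        fix n :: nat
        have "(- b - n) / B \<le> - b / B"
          using that by (intro divide_right_mono) auto
        with * show "(- b - n) / B < \<kappa>" by linarith
      qed
    qed
    thus ?thesis
      using that by (subst is_pole_Gamma_affine_iff) auto
  qed
  have fun_eq: "(\<lambda>s. Gamma (1 - of_real a1 - of_real A1 * s)) =
          (\<lambda>s::complex. Gamma (of_real (1 - a1) + of_real (- A1) * s))"
    by simp
  have "(\<forall>s. is_pole (\<lambda>s. Gamma (1 - of_real a1 - of_real A1 * s)) s \<longrightarrow> \<kappa> < Re s) \<longleftrightarrow>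
          (\<forall>n::nat. \<kappa> < (- (1 - a1) - n) / (- A1))"
    using assms(1) unfolding fun_eq by (subst is_pole_Gamma_affine_iff) auto
  also have "\<dots> \<longleftrightarrow> \<kappa> < (1 - a1) / A1"
  proof
    assume "\<forall>n::nat. \<kappa> < (- (1 - a1) - n) / (- A1)"
    from spec [OF this, of 0] show "\<kappa> < (1 - a1) / A1"
      by (simp add: divide_simps split: if_splits)
  next
    assume *: "\<kappa> < (1 - a1) / A1"
    show "\<forall>n::nat. \<kappa> < (- (1 - a1) - n) / (- A1)"
    proof
      fix n :: nat
      have "(1 - a1) / A1 \<le> (1 - a1 + n) / A1"
        using assms(1) by (intro divide_right_mono) auto
      also have "\<dots> = (- (1 - a1) - n) / (- A1)"
        using assms(1) by (simp add: field_simps)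
      finally show "\<kappa> < (- (1 - a1) - n) / (- A1)" using * by linarith
    qed
  qed
  finally show ?thesis
    using left [OF assms(2), of b1] left [OF assms(3), of b2]
    unfolding H_separating_def by auto
qed

lemma H_separating_case_iff:
  fixes \<alpha> \<beta> \<gamma> \<delta> \<rho> \<kappa> :: real
  assumes "\<delta> > 0" "\<rho> > 0"
  shows "H_separating \<kappa> (1 - (2 + \<alpha>) / \<delta>) (1 / \<delta>) (\<gamma> / \<rho>) (1 / \<rho>) (\<beta> - 1 / \<delta>) (1 / \<delta>) \<longleftrightarrow>
           max (- \<gamma>) (1 - \<beta> * \<delta>) < \<kappa> \<and> \<kappa> < 2 + \<alpha>"
proof -
  have "- (\<beta> - 1 / \<delta>) / (1 / \<delta>) = 1 - \<beta> * \<delta>"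
    using assms by (simp add: field_simps)
  thus ?thesis
    using assms by (subst H_separating_iff) simp_all
qed

end

theory Submission
  imports Defs "HOL-Probability.Sinc_Integral" "HOL-Real_Asymp.Real_Asymp"
begin

text \<open>
  Everything rests on the Mellin--Barnes integral that defines the H-function, evaluated in two ways.
  
  The first way gives \<open>g\<^sub>2\<close>. The two Gamma factors with coefficients \<open>\<plusminus>1/\<delta>\<close> have arguments with a
  constant sum, so that their product is a constant times a Beta function, which has an Euler integral
  with kernel \<open>(1 + a v\<^sup>\<delta>)\<^bsup>-((\<alpha>+1)/\<delta>+\<beta>)\<^esup>\<close> (\<open>has_bochner_integral_Beta_exp\<close>). After exchanging the two
  integrations, the remaining factor \<open>\<Gamma>((\<gamma> + s)/\<rho>)\<close> is integrated along the line by the Cahen--Mellin formula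
  \<open>1/(2\<pi>i) \<integral> \<Gamma>(s) x\<^bsup>-s\<^esup> ds = e\<^bsup>-x\<^esup>\<close> (\<open>Cahen_Mellin_integral\<close>) and yields \<open>e\<^bsup>-b(uv)\<^sup>\<rho>\<^esup>\<close>. What is left is
  the convolution integral (\<open>H21_12_eq_log_integral\<close>, \<open>H21_12_eq_integral\<close>). The two integral forms of \<open>g\<^sub>2\<close>
  differ by the scaling \<open>v \<mapsto> v/u\<close>.
  
  The second way gives the confluent hypergeometric functions. For \<open>\<rho> = \<delta>\<close> the new variable \<open>s/\<delta>\<close> makes all
  coefficients \<open>\<plusminus>1\<close>. The non-resonance condition says that the poles of the two Gamma factors on
  the left are disjoint, hence simple; moving the line to \<open>-\<infinity>\<close> collects their residues, and each of the two
  families sums to one \<open>\<^sub>1F\<^sub>1\<close> (\<open>Gamma_product_integral_1F1\<close>).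
  
  The Cahen--Mellin formula and the second evaluation both come from one lemma on closing the contour to
  the left (\<open>vertical_integral_residue_series\<close>). It uses the functional equation of the integrand to
  see that the integrals over the lines \<open>Re s = \<sigma> - n\<close> tend to \<open>0\<close>, and the estimate
  \<open>|\<Gamma>(z)| \<le> C / |Im z|\<^sup>2\<close> for \<open>|Im z| \<ge> 1\<close> on vertical strips (\<open>Gamma_vertical_decay\<close>) to make the integrals over the horizontal sides vanish.
\<close>

section \<open>Euler integrals on the logarithmic scale\<close>

lemma Re_pos_notin_nonpos_Ints: "Re z > 0 \<Longrightarrow> z \<notin> \<int>\<^sub>\<le>\<^sub>0"
  by (auto elim!: nonpos_Ints_cases')

text \<open>
  On the scale \<open>v = e\<^sup>x\<close> multiplicative convolutions become additive ones, and the changes of variables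
  in the Fubini arguments below become translations of the whole line.
\<close>
lemma
  fixes f :: "real \<Rightarrow> 'a::euclidean_space"
  assumes [measurable]: "f \<in> borel_measurable borel"
  shows set_integrable_Ioi_iff_exp:
      "set_integrable lborel {0<..} f \<longleftrightarrow> integrable lborel (\<lambda>x. exp x *\<^sub>R f (exp x))"
    and set_integral_Ioi_exp:
      "(LBINT v:{0<..}. f v) = (LBINT x. exp x *\<^sub>R f (exp x))"
proof -
  have range: "range exp = {0::real<..}"
    by (auto simp: image_iff intro: exp_ln[symmetric])
  have cov: "(\<lambda>x. \<bar>exp x\<bar> *\<^sub>R f (exp x)) absolutely_integrable_on UNIV \<and>
               integral UNIV (\<lambda>x. \<bar>exp x\<bar> *\<^sub>R f (exp x)) = b \<longleftrightarrow>
             f absolutely_integrable_on (exp ` UNIV) \<and> integral (exp ` UNIV) f = b" for b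
    by (rule has_absolute_integral_change_of_variables_real)
       (auto intro!: derivative_eq_intros inj_onI)
  have set_to_lborel: "set_integrable lebesgue S h \<longleftrightarrow> set_integrable lborel S h"
    if "S \<in> sets borel" "h \<in> borel_measurable borel" for S and h :: "real \<Rightarrow> 'a"
    unfolding set_integrable_def using that by (intro integrable_completion) simp
  have int_to_lborel: "integral S h = (LBINT v:S. h v)"
    if "set_integrable lebesgue S h" "S \<in> sets borel" "h \<in> borel_measurable borel"
    for S and h :: "real \<Rightarrow> 'a"
  proof -
    have "integral S h = (LINT x:S|lebesgue. h x)"
      using set_lebesgue_integral_eq_integral(2)[OF that(1)] by simp
    also have "\<dots> = (LBINT v:S. h v)"
      unfolding set_lebesgue_integral_def using that by (intro integral_completion) simp
    finally show ?thesis .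
  qed
  show iff: "set_integrable lborel {0<..} f \<longleftrightarrow> integrable lborel (\<lambda>x. exp x *\<^sub>R f (exp x))"
    using cov set_to_lborel[of "{0<..}" f] set_to_lborel[of UNIV "\<lambda>x. exp x *\<^sub>R f (exp x)"]
    by (auto simp: range set_integrable_def)
  show "(LBINT v:{0<..}. f v) = (LBINT x. exp x *\<^sub>R f (exp x))"
  proof (cases "set_integrable lborel {0<..} f")
    case True
    hence leb: "set_integrable lebesgue {0<..} f"
      by (subst set_to_lborel) auto
    with cov[of "integral {0<..} f"]
    have "set_integrable lebesgue UNIV (\<lambda>x. exp x *\<^sub>R f (exp x))"
         "integral UNIV (\<lambda>x. exp x *\<^sub>R f (exp x)) = integral {0<..} f"
      by (simp_all add: range)
    with leb show ?thesis
      by (simp add: int_to_lborel set_lebesgue_integral_def)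
  next
    case False
    thus ?thesis using iff
      by (simp add: set_lebesgue_integral_def set_integrable_def not_integrable_integral_eq)
  qed
qed

text \<open>
  Euler's integral \<open>\<integral>\<^sub>0\<^sup>\<infinity> v\<^bsup>z-1\<^esup> e\<^bsup>-v\<^esup> dv\<close> after \<open>v = e\<^sup>x\<close>.
\<close>
lemma has_bochner_integral_Gamma_exp:
  fixes z :: complex
  assumes "Re z > 0"
  shows "has_bochner_integral lborel (\<lambda>x. exp (z * of_real x - of_real (exp x))) (Gamma z)"
proof -
  define f :: "real \<Rightarrow> complex"
    where "f = (\<lambda>t. indicator {0<..} t *\<^sub>R (exp ((z - 1) * of_real (ln t)) / of_real (exp t)))"
  have [measurable]: "f \<in> borel_measurable borel"
    unfolding f_def by measurable
  have f_eq: "f t = of_real t powr (z - 1) / of_real (exp t)" if "t > 0" for t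
    using that by (simp add: f_def powr_def Ln_of_real)
  have integrand: "exp x *\<^sub>R f (exp x) = exp (z * of_real x - of_real (exp x))" for x
    by (simp add: f_def exp_of_real [symmetric] exp_diff scaleR_conv_of_real left_diff_distrib)
  have abs_int: "f absolutely_integrable_on {0<..}"
  proof (rule set_integrable_cong [THEN iffD1, rotated 3])
    show "(\<lambda>t. of_real t powr (z - 1) / of_real (exp t)) absolutely_integrable_on {0<..}"
      by (rule absolutely_integrable_Gamma_integral') (rule assms)
  qed (auto simp: f_eq)
  hence int: "set_integrable lborel {0<..} f"
    unfolding set_integrable_def by (subst (asm) integrable_completion) auto
  have "(f has_integral Gamma z) {0<..}"
    by (rule has_integral_cong [THEN iffD1, OF _ Gamma_integral_complex' [OF assms]])
       (simp add: f_eq)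
  moreover have "(f has_integral (LBINT v:{0<..}. f v)) {0<..}"
  proof -
    have "(f has_integral (LINT v:{0<..}|lebesgue. f v)) {0<..}"
      by (rule has_integral_set_lebesgue) (rule abs_int)
    also have "(LINT v:{0<..}|lebesgue. f v) = (LBINT v:{0<..}. f v)"
      unfolding set_lebesgue_integral_def by (rule integral_completion) measurable
    finally show ?thesis .
  qed
  ultimately have "(LBINT v:{0<..}. f v) = Gamma z"
    by (rule has_integral_unique [symmetric])
  thus ?thesis
    using int by (simp add: has_bochner_integral_iff set_integrable_Ioi_iff_exp
                    set_integral_Ioi_exp integrand)
qed

lemma has_bochner_integral_Gamma_exp_real:
  fixes r :: real
  assumes "r > 0"
  shows "has_bochner_integral lborel (\<lambda>x. exp (r * x - exp x)) (Gamma r)"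
proof -
  have "has_bochner_integral lborel (\<lambda>x. Re (exp (of_real r * of_real x - of_real (exp x))))
          (Re (Gamma (complex_of_real r)))"
    by (intro has_bochner_integral_Re has_bochner_integral_Gamma_exp) (simp add: assms)
  moreover have "Re (exp (complex_of_real r * of_real x - of_real (exp x))) = exp (r * x - exp x)" for x
    by (simp only: of_real_mult [symmetric] of_real_diff [symmetric] exp_of_real Re_complex_of_real)
  ultimately show ?thesis
    by (simp add: Gamma_complex_of_real)
qed

text \<open>
  The substitution \<open>v = e\<^sup>w\<close> in \<open>B(P,Q) = \<integral>\<^sub>0\<^sup>\<infinity> v\<^bsup>P-1\<^esup> (1 + v)\<^bsup>-(P+Q)\<^esup> dv\<close> for complex parameters. The product
  \<open>\<Gamma>(P) \<Gamma>(Q)\<close> is a double integral over \<open>(x, y)\<close>; with \<open>x = y + w\<close> its exponent is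
  \<open>P w + (P + Q) y - e\<^sup>y (1 + e\<^sup>w)\<close>, and the integral over \<open>y\<close> is \<open>\<Gamma>(P + Q) (1 + e\<^sup>w)\<^bsup>-(P+Q)\<^esup>\<close>.
\<close>
lemma has_bochner_integral_Beta_exp:
  fixes P Q :: complex
  assumes P: "Re P > 0" and Q: "Re Q > 0"
  shows "has_bochner_integral lborel
           (\<lambda>w. exp (P * of_real w - (P + Q) * of_real (ln (1 + exp w)))) (Beta P Q)"
proof -
  define h :: "real \<times> real \<Rightarrow> complex" where
    "h = (\<lambda>(y, w). exp (P * of_real w + (P + Q) * of_real y - of_real (exp y * (1 + exp w))))"
  have [measurable]: "h \<in> borel_measurable (lborel \<Otimes>\<^sub>M lborel)"
    unfolding h_def by measurable
  have gamma_int: "integrable lborel (\<lambda>x. exp (z * of_real x - of_real (exp x)))"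
    and gamma_eq: "(LBINT x. exp (z * of_real x - of_real (exp x))) = Gamma z"
    if "Re z > 0" for z :: complex
    using has_bochner_integral_Gamma_exp[OF that] by (simp_all add: has_bochner_integral_iff)
  have shift_int: "has_bochner_integral lborel (\<lambda>x. g (t + x)) I"
    if "has_bochner_integral lborel g I" for g :: "real \<Rightarrow> complex" and t I
    using that lborel_has_bochner_integral_real_affine_iff[of 1 g I t] by simp
  \<comment> \<open>integrating out \<open>w\<close> leaves the integrand of \<open>\<Gamma>(Q)\<close>\<close>
  have w_slice: "has_bochner_integral lborel (\<lambda>w. h (y, w))
                   (exp (Q * of_real y - of_real (exp y)) * Gamma P)" for y
  proof -
    have eq: "h (y, w) = exp (Q * of_real y - of_real (exp y)) *
            exp (P * of_real (y + w) - of_real (exp (y + w)))" for w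
      unfolding h_def by (simp add: exp_add [symmetric] algebra_simps)
    show ?thesis unfolding eq
      by (intro has_bochner_integral_mult_right shift_int has_bochner_integral_Gamma_exp P)
  qed
  \<comment> \<open>integrating out \<open>y\<close> leaves the integrand of the Beta integral times \<open>\<Gamma>(P + Q)\<close>\<close>
  have y_slice: "has_bochner_integral lborel (\<lambda>y. h (y, w))
                   (exp (P * of_real w - (P + Q) * of_real (ln (1 + exp w))) * Gamma (P + Q))" for w
  proof -
    have eq: "h (y, w) = exp (P * of_real w - (P + Q) * of_real (ln (1 + exp w))) *
            exp ((P + Q) * of_real (ln (1 + exp w) + y) - of_real (exp (ln (1 + exp w) + y)))" for y
    proof -
      have "exp (ln (1 + exp w) + y) = (1 + exp w) * exp y"
        by (simp add: exp_add add_pos_pos)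
      thus ?thesis
        unfolding h_def by (simp add: exp_add [symmetric] algebra_simps del: of_real_exp)
    qed
    show ?thesis unfolding eq using P Q
      by (intro has_bochner_integral_mult_right shift_int has_bochner_integral_Gamma_exp) simp
  qed
  have norm_h: "norm (h (y, w)) = exp (Re Q * y - exp y) * exp (Re P * (y + w) - exp (y + w))" for y w
    unfolding h_def by (simp add: exp_add [symmetric] algebra_simps)
  note real_gamma = has_bochner_integral_Gamma_exp_real
  have h_int: "integrable (lborel \<Otimes>\<^sub>M lborel) h"
  proof (rule lborel_pair.Fubini_integrable)
    have "has_bochner_integral lborel (\<lambda>w. norm (h (y, w))) (exp (Re Q * y - exp y) * Gamma (Re P))" for y
    proof -
      have "has_bochner_integral lborel (\<lambda>w. exp (Re P * (y + w) - exp (y + w))) (Gamma (Re P))"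
        using real_gamma[OF P] 
          lborel_has_bochner_integral_real_affine_iff[of 1 "\<lambda>x. exp (Re P * x - exp x)" "Gamma (Re P)" y]
        by simp
      thus ?thesis
        unfolding norm_h by (intro has_bochner_integral_mult_right)
    qed
    hence "(\<lambda>y. LBINT w. norm (h (y, w))) = (\<lambda>y. exp (Re Q * y - exp y) * Gamma (Re P))"
      by (simp add: has_bochner_integral_iff)
    thus "integrable lborel (\<lambda>y. LBINT w. norm (h (y, w)))"
      using real_gamma[OF Q] by (simp add: has_bochner_integral_iff)
    show "AE y in lborel. integrable lborel (\<lambda>w. h (y, w))"
      using w_slice by (auto simp: has_bochner_integral_iff)
  qed measurable
  have ne: "Gamma (P + Q) \<noteq> 0"
    using P Q by (simp add: Gamma_eq_zero_iff Re_pos_notin_nonpos_Ints)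
  have "integrable lborel (\<lambda>w. LBINT y. h (y, w))"
    using lborel_pair.integrable_snd[of "\<lambda>y w. h (y, w)"] h_int by simp
  hence "integrable lborel (\<lambda>w. exp (P * of_real w - (P + Q) * of_real (ln (1 + exp w))) *
           Gamma (P + Q))"
    using y_slice by (simp add: has_bochner_integral_iff)
  from integrable_divide_zero[OF this, of "Gamma (P + Q)"]
  have "integrable lborel (\<lambda>w. exp (P * of_real w - (P + Q) * of_real (ln (1 + exp w))))"
    using ne by simp
  moreover have "(LBINT w. LBINT y. h (y, w)) = (LBINT y. LBINT w. h (y, w))"
    using lborel_pair.Fubini_integral[of "\<lambda>y w. h (y, w)"] h_int by simp
  hence "(LBINT w. exp (P * of_real w - (P + Q) * of_real (ln (1 + exp w)))) * Gamma (P + Q) =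
           Gamma P * Gamma Q"
    using y_slice w_slice gamma_eq[OF Q] by (simp add: has_bochner_integral_iff mult_ac)
  ultimately show ?thesis
    using ne by (simp add: has_bochner_integral_iff Beta_def field_simps)
qed

section \<open>Growth of the Gamma function\<close>

text \<open>
  The functional equation holds even at the poles, where both sides are \<open>0\<close> by the convention that
  \<open>\<Gamma>\<close> vanishes there; only \<open>z = 1\<close> is exceptional.
\<close>
lemma Gamma_eq_minus1:
  fixes z :: "'a :: Gamma"
  assumes "z \<noteq> 1"
  shows "Gamma z = (z - 1) * Gamma (z - 1)"
proof (cases "z - 1 \<in> \<int>\<^sub>\<le>\<^sub>0")
  case False
  thus ?thesis using Gamma_plus1[of "z - 1"] by simp
next
  case True
  then obtain k where k: "z - 1 = - of_nat k" by (auto elim!: nonpos_Ints_cases')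
  with assms have "k \<noteq> 0" by (cases k) auto
  then obtain m where "k = Suc m" by (cases k) auto
  with k have "z = - of_nat m" by (simp add: eq_neg_iff_add_eq_0 algebra_simps)
  hence "Gamma z = 0" by (auto simp: Gamma_eq_zero_iff)
  moreover have "Gamma (z - 1) = 0" using True by (simp add: Gamma_eq_zero_iff)
  ultimately show ?thesis by simp
qed

text \<open>
  The triangle inequality in Euler's integral.
\<close>
lemma norm_Gamma_le:
  fixes z :: complex
  assumes "Re z > 0"
  shows "norm (Gamma z) \<le> Gamma (Re z)"
proof -
  have norm_eq: "norm (exp (z * of_real x - of_real (exp x))) = exp (Re z * x - exp x)" for x
    by simp
  note * = has_bochner_integral_Gamma_exp_real[OF assms]
  have "norm (LBINT x. exp (z * of_real x - of_real (exp x)))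
          \<le> (LBINT x. norm (exp (z * of_real x - of_real (exp x))))"
    by (rule integral_norm_bound)
  thus ?thesis
    using has_bochner_integral_Gamma_exp[OF assms] *
    unfolding norm_eq by (simp add: has_bochner_integral_iff)
qed

text \<open>
  In \<open>\<Gamma>(z) = \<Gamma>(z + N) / (z (z + 1) \<dots> (z + N - 1))\<close> the numerator is
  bounded by the maximum of the real \<open>\<Gamma>\<close> on a compact interval, and each factor of the denominator is at least \<open>|Im z|\<close>.
\<close>
lemma Gamma_vertical_decay:
  fixes l u :: real
  obtains C where "C \<ge> 0"
    "\<And>z::complex. l \<le> Re z \<Longrightarrow> Re z \<le> u \<Longrightarrow> \<bar>Im z\<bar> \<ge> 1 \<Longrightarrow> norm (Gamma z) \<le> C / (Im z)\<^sup>2"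
proof -
  \<comment> \<open>\<open>z + N\<close> has real part at least \<open>1\<close>, and \<open>N \<ge> 2\<close> gives the quadratic decay\<close>
  define N where "N = nat \<lceil>1 - l\<rceil> + 2"
  have N: "l + real N \<ge> 1" "N \<ge> 2"
    unfolding N_def by linarith+
  have "continuous_on {l..u} (\<lambda>x. Gamma (x + real N))"
  proof (intro continuous_on_compose2[OF continuous_on_Gamma[of "{0<..}"]])
    show "(\<lambda>x. x + real N) ` {l..u} \<subseteq> {0<..}"
      using N by auto
  qed (auto intro!: continuous_intros elim!: nonpos_Ints_cases')
  hence "compact ((\<lambda>x. Gamma (x + real N)) ` {l..u})"
    by (intro compact_continuous_image) auto
  then obtain C where C: "\<And>x. x \<in> {l..u} \<Longrightarrow> norm (Gamma (x + real N)) \<le> C"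
    by (meson compact_imp_bounded bounded_iff imageI)
  show ?thesis
  proof (rule that[of "max C 0"])
    fix z :: complex
    assume z: "l \<le> Re z" "Re z \<le> u" "\<bar>Im z\<bar> \<ge> 1"
    have im: "Im z \<noteq> 0" using z by auto
    hence nonpole: "z \<notin> \<int>\<^sub>\<le>\<^sub>0"
      by (auto elim!: nonpos_Ints_cases')
    have "(Im z)\<^sup>2 \<le> \<bar>Im z\<bar> ^ N"
      using power_increasing[OF N(2) z(3)] by simp
    also have "\<dots> = (\<Prod>i<N. \<bar>Im z\<bar>)"
      by simp
    also have "\<dots> \<le> (\<Prod>i<N. norm (z + of_nat i))"
    proof (intro prod_mono conjI)
      fix i
      show "\<bar>Im z\<bar> \<le> norm (z + of_nat i)"
        using abs_Im_le_cmod[of "z + of_nat i"] by simp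
    qed simp
    also have "\<dots> = norm (pochhammer z N)"
      by (simp add: pochhammer_prod prod_norm atLeast0LessThan)
    finally have poch: "(Im z)\<^sup>2 \<le> norm (pochhammer z N)" .
    have "norm (Gamma (z + of_nat N)) \<le> Gamma (Re z + N)"
      using norm_Gamma_le[of "z + of_nat N"] z N by simp
    also have "\<dots> \<le> max C 0"
      using C[of "Re z"] z by auto
    finally have num: "norm (Gamma (z + of_nat N)) \<le> max C 0" .
    have "Gamma z = Gamma (z + of_nat N) / pochhammer z N"
      using pochhammer_Gamma[OF nonpole, of N] poch im by (auto simp: field_simps)
    hence "norm (Gamma z) = norm (Gamma (z + of_nat N)) / norm (pochhammer z N)"
      by (simp add: norm_divide)
    also have "\<dots> \<le> max C 0 / (Im z)\<^sup>2"
      using num poch im by (intro frac_le) auto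
    finally show "norm (Gamma z) \<le> max C 0 / (Im z)\<^sup>2" .
  qed auto
qed

text \<open>
  The sum of the two boundary values bounds \<open>x\<^bsup>-z\<^esup>\<close> on the strip whether \<open>x < 1\<close> or \<open>x \<ge> 1\<close>.
\<close>
lemma norm_powr_strip_le:
  fixes x :: real
  assumes "x > 0" "l \<le> Re z" "Re z \<le> u"
  shows "norm (of_real x powr (- z)) \<le> x powr (- l) + x powr (- u)"
proof -
  have "norm (of_real x powr (- z)) = x powr (- Re z)"
    using assms by (simp add: norm_powr_real_powr)
  also have "\<dots> \<le> x powr (- l) + x powr (- u)"
  proof (cases "x \<ge> 1")
    case True
    hence "x powr (- Re z) \<le> x powr (- l)"
      using assms by (intro powr_mono) auto
    thus ?thesis by (simp add: add_increasing2)
  next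
    case False
    hence "x powr (- Re z) \<le> x powr (- u)"
      using assms by (intro powr_mono') auto
    thus ?thesis by (simp add: add_increasing)
  qed
  finally show ?thesis .
qed

section \<open>Evaluating vertical line integrals by residues\<close>

lemma integrable_vertical_line:
  fixes F :: "complex \<Rightarrow> complex"
  assumes cont: "continuous_on {z. Re z = \<sigma>} F"
    and decay: "\<And>z. Re z = \<sigma> \<Longrightarrow> \<bar>Im z\<bar> \<ge> 1 \<Longrightarrow> norm (F z) \<le> C / (Im z)\<^sup>2"
  shows "integrable lborel (\<lambda>t. F (Complex \<sigma> t))"
proof -
  have contF: "continuous_on A (\<lambda>t. F (Complex \<sigma> t))" for A
    by (intro continuous_on_compose2[OF cont]) (auto simp: Complex_eq intro!: continuous_intros)
  hence [measurable]: "(\<lambda>t. F (Complex \<sigma> t)) \<in> borel_measurable borel"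
    by (intro borel_measurable_continuous_onI)
  have "compact ((\<lambda>t. F (Complex \<sigma> t)) ` {-1..1})"
    by (intro compact_continuous_image contF) auto
  then obtain D where D: "\<And>t. t \<in> {-1..1} \<Longrightarrow> norm (F (Complex \<sigma> t)) \<le> D"
    by (meson compact_imp_bounded bounded_iff imageI)
  define K where "K = 2 * max \<bar>C\<bar> D"
  have bound: "norm (F (Complex \<sigma> t)) \<le> K * inverse (1 + t\<^sup>2)" for t
  proof (cases "\<bar>t\<bar> \<ge> 1")
    case True
    hence t2: "t\<^sup>2 \<ge> 1" using one_le_power[of "\<bar>t\<bar>" 2] by simp
    have "norm (F (Complex \<sigma> t)) \<le> C / t\<^sup>2"
      using decay[of "Complex \<sigma> t"] True by simp
    also have "\<dots> \<le> max \<bar>C\<bar> D / t\<^sup>2"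
      by (intro divide_right_mono) auto
    also have "\<dots> = K / (2 * t\<^sup>2)"
      by (simp add: K_def)
    also have "\<dots> \<le> K / (1 + t\<^sup>2)"
      using t2 by (intro divide_left_mono) (auto simp: K_def intro!: mult_pos_pos)
    finally show ?thesis by (simp add: field_simps)
  next
    case False
    hence t2: "t\<^sup>2 \<le> 1" by (simp add: abs_square_le_1)
    have "norm (F (Complex \<sigma> t)) \<le> D"
      using False by (intro D) (auto simp: abs_le_iff)
    also have "\<dots> \<le> max \<bar>C\<bar> D"
      by simp
    also have "\<dots> = K / 2"
      by (simp add: K_def)
    also have "\<dots> \<le> K / (1 + t\<^sup>2)"
      using t2 by (intro divide_left_mono) (auto simp: K_def add_pos_nonneg)
    finally show ?thesis by (simp add: field_simps)
  qed
  show ?thesis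
  proof (rule Bochner_Integration.integrable_bound)
    show "integrable lborel (\<lambda>t::real. K * inverse (1 + t\<^sup>2))"
      using integrable_inverse_1_plus_square by (simp add: set_integrable_def)
    show "AE t in lborel. norm (F (Complex \<sigma> t)) \<le> norm (K * inverse (1 + t\<^sup>2))"
      by (intro AE_I2 order.trans[OF bound]) simp
  qed measurable
qed

lemma symmetric_truncation_tendsto:
  fixes f :: "real \<Rightarrow> complex"
  assumes int: "integrable lborel f" and cont: "continuous_on UNIV f"
  shows "(\<lambda>n. integral {- real n..real n} f) \<longlonglongrightarrow> (LBINT t. f t)"
proof -
  have "(\<lambda>n. LBINT t. indicator {- real n..real n} t *\<^sub>R f t) \<longlonglongrightarrow> (LBINT t. f t)"
  proof (rule integral_dominated_convergence[where w = "\<lambda>t. norm (f t)"])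
    show "AE t in lborel. (\<lambda>n. indicator {- real n..real n} t *\<^sub>R f t) \<longlonglongrightarrow> f t"
    proof (intro AE_I2 tendsto_eventually)
      fix t :: real
      show "\<forall>\<^sub>F n in sequentially. indicator {- real n..real n} t *\<^sub>R f t = f t"
        using eventually_ge_at_top[of "nat \<lceil>\<bar>t\<bar>\<rceil>"]
      proof eventually_elim
        case (elim n)
        hence "\<bar>t\<bar> \<le> real n" by linarith
        thus ?case by (auto simp: indicator_def abs_le_iff)
      qed
    qed
  qed (use int in \<open>auto simp: indicator_def\<close>)
  moreover have "(LBINT t. indicator {- real n..real n} t *\<^sub>R f t) = integral {- real n..real n} f" for n
    using set_borel_integral_eq_integral(2)[OF borel_integrable_atLeastAtMost'[of "-real n" "real n" f]]
      continuous_on_subset[OF cont] by (simp add: set_lebesgue_integral_def)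
  ultimately show ?thesis by simp
qed

text \<open>
  The residue theorem on the rectangle with corners \<open>\<sigma> \<plusminus> i n\<close> and \<open>\<kappa> \<plusminus> i n\<close>: as \<open>n\<close> grows, the decay
  hypothesis makes the horizontal sides vanish and the vertical sides converge to the two line
  integrals. The poles are real, so they never meet the horizontal sides.
\<close>
lemma vertical_line_shift:
  fixes F :: "complex \<Rightarrow> complex" and P :: "complex set"
  assumes lines: "L < \<sigma>" "\<sigma> < \<kappa>" "\<kappa> < R"
    and P: "finite P" "P \<subseteq> \<real>" "\<And>p. p \<in> P \<Longrightarrow> Re p \<noteq> \<sigma> \<and> Re p \<noteq> \<kappa>"
    and holo: "F holomorphic_on {z. L < Re z \<and> Re z < R} - P"
    and decay: "\<And>z. \<sigma> \<le> Re z \<Longrightarrow> Re z \<le> \<kappa> \<Longrightarrow> \<bar>Im z\<bar> \<ge> 1 \<Longrightarrow> norm (F z) \<le> C / (Im z)\<^sup>2"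
  shows "(LBINT t. F (Complex \<kappa> t)) - (LBINT t. F (Complex \<sigma> t)) =
           2 * of_real pi * (\<Sum>p\<in>{p\<in>P. \<sigma> < Re p \<and> Re p < \<kappa>}. residue F p)"
proof -
  define S where "S = {z. L < Re z \<and> Re z < R}"
  have S: "open S" "convex S"
    unfolding S_def using convex_halfspace_Re_gt[of L] convex_halfspace_Re_lt[of R]
    by (auto simp: Collect_conj_eq intro!: open_Int open_halfspace_Re_gt open_halfspace_Re_lt convex_Int)
  have contF: "continuous_on (S - P) F"
    using holo unfolding S_def by (rule holomorphic_on_imp_continuous_on)
  have Im_P: "Im p = 0" if "p \<in> P" for p
    using P(2) that by (auto simp: complex_is_Real_iff)
  define rsum where "rsum = (\<Sum>p\<in>{p\<in>P. \<sigma> < Re p \<and> Re p < \<kappa>}. residue F p)"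
  \<comment> \<open>\<open>V x n\<close> is the integral along the side \<open>Re z = x\<close> of the rectangle, up to the factor \<open>\<i>\<close>\<close>
  define V where "V = (\<lambda>x n. integral {- real n..real n} (\<lambda>t. F (Complex x t)))"
  have line: "V x \<longlonglongrightarrow> (LBINT t. F (Complex x t))" if x: "x = \<sigma> \<or> x = \<kappa>" for x
    unfolding V_def
  proof (rule symmetric_truncation_tendsto)
    have cont: "continuous_on {z. Re z = x} F"
      using lines P(3) x by (intro continuous_on_subset[OF contF]) (auto simp: S_def)
    show "continuous_on UNIV (\<lambda>t. F (Complex x t))"
      by (intro continuous_on_compose2[OF cont]) (auto simp: Complex_eq intro!: continuous_intros)
    show "integrable lborel (\<lambda>t. F (Complex x t))"
      using lines x by (intro integrable_vertical_line[OF cont, of C] decay) auto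
  qed
  \<comment> \<open>minus the contribution of the two horizontal sides\<close>
  define E where "E = (\<lambda>n. \<i> * (V \<kappa> n - V \<sigma> n) - 2 * of_real pi * \<i> * rsum)"
  have E_bound: "norm (E n) \<le> 2 * \<bar>C\<bar> * (\<kappa> - \<sigma>) / (real n)\<^sup>2" if n: "n > 0" for n
  proof -
    define c1 c2 c3 c4 where "c1 = Complex \<sigma> (- real n)" and "c2 = Complex \<kappa> (- real n)"
      and "c3 = Complex \<kappa> (real n)" and "c4 = Complex \<sigma> (real n)"
    define B where "B = \<bar>C\<bar> / (real n)\<^sup>2"
    have rect: "rectpath c1 c3 = linepath c1 c2 +++ linepath c2 c3 +++ linepath c3 c4 +++ linepath c4 c1"
      by (simp add: rectpath_def c1_def c2_def c3_def c4_def Let_def)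
    have image: "path_image (rectpath c1 c3) \<subseteq> S - P"
    proof
      fix z assume "z \<in> path_image (rectpath c1 c3)"
      also have "path_image (rectpath c1 c3) =
          {z. Re z \<in> {\<sigma>, \<kappa>} \<and> Im z \<in> {-real n..real n}} \<union>
          {z. Im z \<in> {-real n, real n} \<and> Re z \<in> {\<sigma>..\<kappa>}}"
        using path_image_rectpath[of c1 c3] lines by (simp add: c1_def c3_def)
      finally have z: "Re z \<in> {\<sigma>, \<kappa>} \<or> Im z \<noteq> 0" "\<sigma> \<le> Re z" "Re z \<le> \<kappa>"
        using n lines by auto
      from z(1) have "z \<notin> P"
        using P(3)[of z] Im_P[of z] by auto
      with z lines show "z \<in> S - P" by (auto simp: S_def)
    qed
    have segs: "closed_segment c1 c2 \<subseteq> S - P" "closed_segment c2 c3 \<subseteq> S - P"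
      "closed_segment c3 c4 \<subseteq> S - P" "closed_segment c4 c1 \<subseteq> S - P"
      using image unfolding rect by (auto simp: path_image_join)
    have cint: "F contour_integrable_on linepath a b" if "closed_segment a b \<subseteq> S - P" for a b
      by (intro contour_integrable_continuous_linepath continuous_on_subset[OF contF] that)
    have "contour_integral (rectpath c1 c3) F =
            2 * pi * \<i> * (\<Sum>p\<in>P. winding_number (rectpath c1 c3) p * residue F p)"
    proof (rule Residue_theorem[of S])
      show "connected S" by (intro convex_connected S)
      show "\<forall>z. z \<notin> S \<longrightarrow> winding_number (rectpath c1 c3) z = 0"
        using image S by (intro allI impI winding_number_zero_outside[of _ S]) auto
    qed (use S P holo image in \<open>auto simp: S_def\<close>)
    also have "(\<Sum>p\<in>P. winding_number (rectpath c1 c3) p * residue F p) =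
                 (\<Sum>p\<in>P. if \<sigma> < Re p \<and> Re p < \<kappa> then residue F p else 0)"
    proof (intro sum.cong refl)
      fix p assume p: "p \<in> P"
      show "winding_number (rectpath c1 c3) p * residue F p =
              (if \<sigma> < Re p \<and> Re p < \<kappa> then residue F p else 0)"
      proof (cases "\<sigma> < Re p \<and> Re p < \<kappa>")
        case True
        hence "p \<in> box c1 c3"
          using n Im_P[OF p] by (auto simp: in_box_complex_iff c1_def c3_def)
        thus ?thesis using True by (simp add: winding_number_rectpath)
      next
        case False
        hence "p \<notin> cbox c1 c3"
          using P(3)[OF p] by (auto simp: in_cbox_complex_iff c1_def c3_def)
        hence "winding_number (rectpath c1 c3) p = 0"
          using lines n by (intro winding_number_rectpath_outside) (auto simp: c1_def c3_def)
        thus ?thesis using False by auto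
      qed
    qed
    also have "\<dots> = rsum"
      unfolding rsum_def using P(1) by (simp add: sum.If_cases Int_def)
    finally have res: "contour_integral (rectpath c1 c3) F = 2 * pi * \<i> * rsum" .
    have "contour_integral (rectpath c1 c3) F =
            contour_integral (linepath c1 c2) F + (contour_integral (linepath c2 c3) F +
            (contour_integral (linepath c3 c4) F + contour_integral (linepath c4 c1) F))"
    proof -
      have "F contour_integrable_on (linepath c3 c4 +++ linepath c4 c1)"
        by (intro contour_integrable_joinI cint segs) auto
      moreover from this have "F contour_integrable_on (linepath c2 c3 +++ linepath c3 c4 +++ linepath c4 c1)"
        by (intro contour_integrable_joinI cint segs) auto
      ultimately show ?thesis
        unfolding rect by (simp add: contour_integral_join cint segs)
    qed
    also have "contour_integral (linepath c2 c3) F = \<i> * V \<kappa> n"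
      unfolding V_def using n by (intro contour_integral_linepath_same_Re) (auto simp: c2_def c3_def)
    also have "contour_integral (linepath c4 c1) F = - contour_integral (linepath c1 c4) F"
      using segs(4) contour_integral_reversepath[of "linepath c1 c4" F] by simp
    also have "contour_integral (linepath c1 c4) F = \<i> * V \<sigma> n"
      unfolding V_def using n by (intro contour_integral_linepath_same_Re) (auto simp: c1_def c4_def)
    finally have "E n = - (contour_integral (linepath c1 c2) F + contour_integral (linepath c3 c4) F)"
      unfolding res E_def by (simp add: algebra_simps)
    moreover have "norm (contour_integral (linepath c1 c2) F) \<le> B * norm (c2 - c1)"
    proof (intro contour_integral_bound_linepath cint segs)
      fix x assume "x \<in> closed_segment c1 c2"
      hence "Im x = - real n" "\<sigma> \<le> Re x" "Re x \<le> \<kappa>"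
        using lines by (auto simp: c1_def c2_def closed_segment_same_Im closed_segment_eq_real_ivl)
      hence "norm (F x) \<le> C / (real n)\<^sup>2" using decay[of x] n by simp
      also have "\<dots> \<le> B" unfolding B_def by (intro divide_right_mono) auto
      finally show "norm (F x) \<le> B" .
    qed (auto simp: B_def)
    moreover have "norm (contour_integral (linepath c3 c4) F) \<le> B * norm (c4 - c3)"
    proof (intro contour_integral_bound_linepath cint segs)
      fix x assume "x \<in> closed_segment c3 c4"
      hence "Im x = real n" "\<sigma> \<le> Re x" "Re x \<le> \<kappa>"
        using lines by (auto simp: c3_def c4_def closed_segment_same_Im closed_segment_eq_real_ivl)
      hence "norm (F x) \<le> C / (real n)\<^sup>2" using decay[of x] n by simp
      also have "\<dots> \<le> B" unfolding B_def by (intro divide_right_mono) auto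
      finally show "norm (F x) \<le> B" .
    qed (auto simp: B_def)
    moreover have "norm (c2 - c1) = \<kappa> - \<sigma>" "norm (c4 - c3) = \<kappa> - \<sigma>"
      using lines by (auto simp: c1_def c2_def c3_def c4_def cmod_def)
    ultimately have "norm (E n) \<le> B * (\<kappa> - \<sigma>) + B * (\<kappa> - \<sigma>)"
      by (simp only: norm_minus_cancel) (meson add_mono norm_triangle_ineq order.trans)
    thus ?thesis by (simp add: B_def field_simps)
  qed
  have "(\<lambda>n. 2 * \<bar>C\<bar> * (\<kappa> - \<sigma>) / (real n)\<^sup>2) \<longlonglongrightarrow> 0"
    by (rule real_tendsto_divide_at_top[OF tendsto_const])
       (intro filterlim_pow_at_top filterlim_real_sequentially; simp)
  hence "E \<longlonglongrightarrow> 0"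
    by (rule Lim_null_comparison[rotated])
       (use eventually_gt_at_top[of 0] in eventually_elim, rule E_bound)
  moreover have "E \<longlonglongrightarrow> \<i> * ((LBINT t. F (Complex \<kappa> t)) - (LBINT t. F (Complex \<sigma> t)))
                      - 2 * of_real pi * \<i> * rsum"
    unfolding E_def by (intro tendsto_intros line) auto
  ultimately have "\<i> * ((LBINT t. F (Complex \<kappa> t)) - (LBINT t. F (Complex \<sigma> t)))
                      - 2 * of_real pi * \<i> * rsum = 0"
    by (metis LIMSEQ_unique)
  hence "\<i> * ((LBINT t. F (Complex \<kappa> t)) - (LBINT t. F (Complex \<sigma> t)) - 2 * of_real pi * rsum) = 0"
    by (simp only: right_diff_distrib mult_ac)
  thus ?thesis
    unfolding rsum_def [symmetric] by simp
qed

text \<open>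
  Closing the contour to the left. The lines \<open>Re z = \<sigma> - n\<close> pass between the poles, and a functional
  equation for \<open>F\<close> bounds the integral of \<open>|F|\<close> over the next line by \<open>\<epsilon>\<^sub>n\<close> times that over the current one.
  Since \<open>\<epsilon>\<^sub>n\<close> tends to \<open>0\<close>, these integrals are eventually dominated by a geometric sequence and tend to \<open>0\<close>, which
  leaves the sum of the residues.
\<close>
lemma vertical_integral_residue_series:
  fixes F :: "complex \<Rightarrow> complex" and P :: "complex set" and \<epsilon> :: "nat \<Rightarrow> real"
  assumes lines: "\<sigma> < \<kappa>" "\<kappa> < R"
    and P: "P \<subseteq> \<real>" "\<And>L. finite {p\<in>P. L < Re p}"
    and avoid: "\<And>p. p \<in> P \<Longrightarrow> Re p \<noteq> \<kappa>" "\<And>p n. p \<in> P \<Longrightarrow> Re p \<noteq> \<sigma> - real n"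
    and holo: "F holomorphic_on {z. Re z < R} - P"
    and decay: "\<And>l. \<exists>C. \<forall>z. l \<le> Re z \<and> Re z \<le> \<kappa> \<and> \<bar>Im z\<bar> \<ge> 1 \<longrightarrow> norm (F z) \<le> C / (Im z)\<^sup>2"
    and step: "\<And>n z. Re z = \<sigma> - real n \<Longrightarrow> norm (F (z - 1)) \<le> \<epsilon> n * norm (F z)"
    and \<epsilon>: "\<epsilon> \<longlonglongrightarrow> 0"
  shows "(\<lambda>n. \<Sum>p\<in>{p\<in>P. \<sigma> - real n < Re p \<and> Re p < \<kappa>}. residue F p)
           \<longlonglongrightarrow> (LBINT t. F (Complex \<kappa> t)) / (2 * of_real pi)"
proof -
  define I where "I = (\<lambda>n. LBINT t. F (Complex (\<sigma> - real n) t))"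
  define J where "J = (\<lambda>n. LBINT t. norm (F (Complex (\<sigma> - real n) t)))"
  have int: "integrable lborel (\<lambda>t. F (Complex (\<sigma> - real n) t))" for n
  proof -
    obtain C where C: "\<And>z. \<sigma> - real n \<le> Re z \<Longrightarrow> Re z \<le> \<kappa> \<Longrightarrow> \<bar>Im z\<bar> \<ge> 1
        \<Longrightarrow> norm (F z) \<le> C / (Im z)\<^sup>2"
      using decay[of "\<sigma> - real n"] by blast
    show ?thesis
    proof (rule integrable_vertical_line[where C = C])
      show "continuous_on {z. Re z = \<sigma> - real n} F"
        by (rule continuous_on_subset[OF holomorphic_on_imp_continuous_on[OF holo]])
           (use lines avoid(2) in force)
    qed (use C lines in auto)
  qed
  have J_step: "J (Suc n) \<le> \<epsilon> n * J n" for n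
  proof -
    have eq: "Complex (\<sigma> - real (Suc n)) t = Complex (\<sigma> - real n) t - 1" for t
      by (simp add: complex_eq_iff)
    have "J (Suc n) \<le> (LBINT t. \<epsilon> n * norm (F (Complex (\<sigma> - real n) t)))"
      unfolding J_def eq using int[of "Suc n", unfolded eq] int[of n]
      by (intro integral_mono integrable_norm integrable_mult_right step) auto
    thus ?thesis unfolding J_def by simp
  qed
  have J_nonneg: "J n \<ge> 0" for n
    unfolding J_def by simp
  have "summable J"
  proof -
    from \<epsilon> have "\<forall>\<^sub>F n in sequentially. \<epsilon> n < 1/2"
      by (rule order_tendstoD) simp
    then obtain N where N: "\<And>n. n \<ge> N \<Longrightarrow> \<epsilon> n < 1/2"
      by (auto simp: eventually_at_top_linorder)
    show ?thesis
    proof (rule summable_ratio_test[of "1/2" N])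
      fix n assume n: "n \<ge> N"
      have "J (Suc n) \<le> \<epsilon> n * J n" by (rule J_step)
      also have "\<dots> \<le> 1/2 * J n"
        using N[OF n] J_nonneg by (intro mult_right_mono) auto
      finally show "norm (J (Suc n)) \<le> 1/2 * norm (J n)"
        using J_nonneg by simp
    qed simp
  qed
  hence "J \<longlonglongrightarrow> 0" by (rule summable_LIMSEQ_zero)
  hence "I \<longlonglongrightarrow> 0"
    by (rule Lim_null_comparison[rotated]) (auto simp: I_def J_def)
  have shift: "(\<Sum>p\<in>{p\<in>P. \<sigma> - real n < Re p \<and> Re p < \<kappa>}. residue F p) =
                 ((LBINT t. F (Complex \<kappa> t)) - I n) / (2 * of_real pi)" for n
  proof -
    define Q where "Q = {p\<in>P. \<sigma> - real n - 1 < Re p}"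
    obtain C where C: "\<And>z. \<sigma> - real n \<le> Re z \<Longrightarrow> Re z \<le> \<kappa> \<Longrightarrow> \<bar>Im z\<bar> \<ge> 1
        \<Longrightarrow> norm (F z) \<le> C / (Im z)\<^sup>2"
      using decay[of "\<sigma> - real n"] by blast
    have "(LBINT t. F (Complex \<kappa> t)) - I n =
            2 * of_real pi * (\<Sum>p\<in>{p\<in>Q. \<sigma> - real n < Re p \<and> Re p < \<kappa>}. residue F p)"
      unfolding I_def
    proof (rule vertical_line_shift[where L = "\<sigma> - real n - 1" and R = R and C = C])
      show "F holomorphic_on {z. \<sigma> - real n - 1 < Re z \<and> Re z < R} - Q"
        by (rule holomorphic_on_subset[OF holo]) (auto simp: Q_def)
      show "finite Q" unfolding Q_def by (rule P(2))
    qed (use lines avoid P(1) C in \<open>auto simp: Q_def\<close>)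
    also have "{p\<in>Q. \<sigma> - real n < Re p \<and> Re p < \<kappa>} = {p\<in>P. \<sigma> - real n < Re p \<and> Re p < \<kappa>}"
      by (auto simp: Q_def)
    finally show ?thesis by simp
  qed
  have "(\<lambda>n. ((LBINT t. F (Complex \<kappa> t)) - I n) / (2 * of_real pi))
          \<longlonglongrightarrow> ((LBINT t. F (Complex \<kappa> t)) - 0) / (2 * of_real pi)"
    by (intro tendsto_intros \<open>I \<longlonglongrightarrow> 0\<close>) simp
  thus ?thesis unfolding shift by simp
qed

lemma residue_Gamma_shift_mult:
  fixes a :: complex
  assumes S: "open S" "- a - of_nat k \<in> S" and G: "G holomorphic_on S"
  shows "residue (\<lambda>s. Gamma (a + s) * G s) (- a - of_nat k) =
           (-1) ^ k / fact k * G (- a - of_nat k)"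
proof (rule residue_simple')
  let ?p = "- a - of_nat k"
  let ?S = "S \<inter> ball ?p 1"
  show "open ?S" using S by auto
  show "?p \<in> ?S" using S by auto
  have "a + s \<notin> \<int>\<^sub>\<le>\<^sub>0" if "s \<in> ball ?p 1 - {?p}" for s
  proof
    assume "a + s \<in> \<int>\<^sub>\<le>\<^sub>0"
    then obtain m where m: "a + s = - of_nat m" by (auto elim!: nonpos_Ints_cases')
    have "s = (a + s) - a" by simp
    also have "\<dots> = - a - of_nat m" unfolding m by simp
    finally have "s = - a - of_nat m" .
    hence "dist ?p s = norm (of_int (int m - int k) :: complex)"
      by (simp add: dist_norm)
    also have "\<dots> = of_int \<bar>int m - int k\<bar>"
      by (simp only: norm_of_int of_int_abs)
    finally have "real_of_int \<bar>int m - int k\<bar> < 1"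
      using that by (simp only: Diff_iff mem_ball)
    hence "\<bar>int m - int k\<bar> < 1" by linarith
    hence "m = k" by linarith
    with \<open>s = - a - of_nat m\<close> that show False by auto
  qed
  thus "(\<lambda>s. Gamma (a + s) * G s) holomorphic_on ?S - {?p}"
    by (intro holomorphic_intros holomorphic_on_subset[OF G]) auto
  have "((\<lambda>w. Gamma (a + w) * ((a + w) + of_nat k)) \<longlongrightarrow> (-1) ^ k / fact k) (at ?p)"
  proof (rule filterlim_compose[OF Gamma_residues])
    show "filterlim (\<lambda>w. a + w) (at (- of_nat k)) (at ?p)"
      unfolding filterlim_at
    proof
      show "\<forall>\<^sub>F w in at ?p. a + w \<in> UNIV \<and> a + w \<noteq> - of_nat k"
        unfolding eventually_at_filter
        by (intro always_eventually) (auto simp: eq_neg_iff_add_eq_0 algebra_simps)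
    qed (auto intro!: tendsto_eq_intros)
  qed
  moreover have "(G \<longlongrightarrow> G ?p) (at ?p)"
    using holomorphic_on_imp_continuous_on[OF G] S by (simp add: continuous_on_eq_continuous_at isCont_def)
  ultimately have "((\<lambda>w. Gamma (a + w) * ((a + w) + of_nat k) * G w) \<longlongrightarrow> (-1) ^ k / fact k * G ?p) (at ?p)"
    by (rule tendsto_mult)
  thus "((\<lambda>w. Gamma (a + w) * G w * (w - ?p)) \<longlongrightarrow> (-1) ^ k / fact k * G ?p) (at ?p)"
    by (simp add: algebra_simps)
qed

section \<open>The Cahen--Mellin integral\<close>

text \<open>
  The residue of \<open>\<Gamma>(s) x\<^bsup>-s\<^esup>\<close> at \<open>-k\<close> is \<open>(-x)\<^sup>k / k!\<close>, so that the sum of the residues is the exponential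
  series. The lines \<open>Re s = -1/2 - n\<close> avoid the poles, and \<open>\<Gamma>(s - 1) = \<Gamma>(s) / (s - 1)\<close> is the functional
  equation that makes the line integrals tend to \<open>0\<close>.
\<close>
theorem Cahen_Mellin_integral:
  fixes c x :: real
  assumes "c > 0" "x > 0"
  shows "(LBINT t. Gamma (Complex c t) * of_real x powr (- Complex c t)) = 2 * of_real pi * of_real (exp (- x))"
proof -
  define F :: "complex \<Rightarrow> complex" where "F = (\<lambda>s. Gamma s * of_real x powr (- s))"
  define P :: "complex set" where "P = range (\<lambda>k. - of_nat k)"
  have "(\<lambda>n. \<Sum>p\<in>{p\<in>P. - 1/2 - real n < Re p \<and> Re p < c}. residue F p)
          \<longlonglongrightarrow> (LBINT t. F (Complex c t)) / (2 * of_real pi)"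
  proof (rule vertical_integral_residue_series[where R = "c + 1" and \<epsilon> = "\<lambda>n. x / (real n + 3/2)"])
    show "P \<subseteq> \<real>" by (auto simp: P_def)
    show "finite {p\<in>P. L < Re p}" for L
    proof (rule finite_subset)
      show "{p\<in>P. L < Re p} \<subseteq> (\<lambda>k. - of_nat k) ` {..nat \<lceil>- L\<rceil>}"
        unfolding P_def by (auto intro!: imageI simp: le_nat_iff) (linarith)
    qed simp
    show "Re p \<noteq> c" if "p \<in> P" for p
      using that assms by (auto simp: P_def)
    show "Re p \<noteq> - 1/2 - real n" if "p \<in> P" for p n
    proof
      assume *: "Re p = - 1/2 - real n"
      from that obtain k where "p = - of_nat k" by (auto simp: P_def)
      with * have "2 * real k = 1 + 2 * real n" by simp
      hence "2 * k = 1 + 2 * n" by linarith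
      thus False by presburger
    qed
    have P_eq: "P = \<int>\<^sub>\<le>\<^sub>0"
      by (auto simp: P_def elim!: nonpos_Ints_cases')
    show "F holomorphic_on {z. Re z < c + 1} - P"
      unfolding F_def P_eq using assms by (intro holomorphic_intros) auto
    show "\<exists>C. \<forall>z. l \<le> Re z \<and> Re z \<le> c \<and> \<bar>Im z\<bar> \<ge> 1 \<longrightarrow> norm (F z) \<le> C / (Im z)\<^sup>2" for l
    proof -
      obtain C where C: "C \<ge> 0"
        "\<And>z::complex. l \<le> Re z \<Longrightarrow> Re z \<le> c \<Longrightarrow> \<bar>Im z\<bar> \<ge> 1 \<Longrightarrow> norm (Gamma z) \<le> C / (Im z)\<^sup>2"
        using Gamma_vertical_decay[of l c] by blast
      have "norm (F z) \<le> C * (x powr (- l) + x powr (- c)) / (Im z)\<^sup>2"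
        if "l \<le> Re z" "Re z \<le> c" "\<bar>Im z\<bar> \<ge> 1" for z
        using mult_mono[OF C(2)[OF that] norm_powr_strip_le[OF assms(2) that(1,2)]] C(1)
        by (simp add: F_def norm_mult)
      thus ?thesis by blast
    qed
    show "norm (F (z - 1)) \<le> x / (real n + 3/2) * norm (F z)" if z: "Re z = - 1/2 - real n" for n z
    proof -
      have "Re (z - 1) < 0" using z by simp
      hence ne: "z - 1 \<noteq> 0" by auto
      hence "Gamma z = (z - 1) * Gamma (z - 1)"
        by (intro Gamma_eq_minus1) auto
      moreover have "of_real x powr (- (z - 1)) = of_real x * of_real x powr (- z)"
        using powr_add[of "complex_of_real x" 1 "- z"] assms by simp
      ultimately have "(z - 1) * F (z - 1) = of_real x * F z"
        unfolding F_def by (simp only: mult_ac)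
      hence "F (z - 1) = of_real x / (z - 1) * F z"
        using ne by (simp add: field_simps)
      hence "norm (F (z - 1)) = x / norm (z - 1) * norm (F z)"
        using assms by (simp add: norm_mult norm_divide)
      also have "\<dots> \<le> x / (real n + 3/2) * norm (F z)"
      proof (intro mult_right_mono divide_left_mono)
        show "real n + 3/2 \<le> norm (z - 1)"
          using abs_Re_le_cmod[of "z - 1"] z by simp
      qed (use assms ne in auto)
      finally show ?thesis .
    qed
    show "(\<lambda>n. x / (real n + 3/2)) \<longlonglongrightarrow> 0"
      by real_asymp
  qed (use assms in auto)
  moreover have "(\<Sum>p\<in>{p\<in>P. - 1/2 - real n < Re p \<and> Re p < c}. residue F p) =
                   (\<Sum>k<Suc n. of_real ((- x) ^ k / fact k))" for n
  proof -
    have "{p\<in>P. - 1/2 - real n < Re p \<and> Re p < c} = (\<lambda>k. - of_nat k) ` {..<Suc n}"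
      using assms by (auto simp: P_def)
    hence "(\<Sum>p\<in>{p\<in>P. - 1/2 - real n < Re p \<and> Re p < c}. residue F p) =
             (\<Sum>k<Suc n. residue F (- of_nat k))"
      by (simp add: sum.reindex inj_on_def)
    also have "\<dots> = (\<Sum>k<Suc n. of_real ((- x) ^ k / fact k))"
    proof (intro sum.cong refl)
      fix k
      have "residue F (- of_nat k) = (-1) ^ k / fact k * of_real x powr (of_nat k)"
      proof -
        have "(\<lambda>s. complex_of_real x powr (- s)) holomorphic_on UNIV"
          using assms by (intro holomorphic_intros) auto
        from residue_Gamma_shift_mult[OF _ _ this, of 0 k] show ?thesis
          by (simp add: F_def)
      qed
      also have "\<dots> = of_real ((- x) ^ k / fact k)"
        using assms by (simp add: power_minus[of x])
      finally show "residue F (- of_nat k) = of_real ((- x) ^ k / fact k)" .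
    qed
    finally show ?thesis .
  qed
  ultimately have "(\<lambda>n. of_real (\<Sum>k<Suc n. (- x) ^ k / fact k))
      \<longlonglongrightarrow> (LBINT t. F (Complex c t)) / (2 * of_real pi)"
    by simp
  moreover have "(\<lambda>n. complex_of_real (\<Sum>k<Suc n. (- x) ^ k / fact k)) \<longlonglongrightarrow> of_real (exp (- x))"
  proof (intro tendsto_of_real)
    have "(\<lambda>k. (- x) ^ k / fact k) sums exp (- x)"
      using exp_converges[of "- x"] by (simp add: scaleR_conv_of_real field_simps)
    thus "(\<lambda>n. \<Sum>k<Suc n. (- x) ^ k / fact k) \<longlonglongrightarrow> exp (- x)"
      unfolding sums_def by (rule LIMSEQ_Suc)
  qed
  ultimately have "(LBINT t. F (Complex c t)) / (2 * of_real pi) = of_real (exp (- x))"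
    by (rule LIMSEQ_unique)
  thus ?thesis by (simp add: F_def field_simps)
qed

lemma integrable_Gamma_vertical:
  assumes "c > 0"
  shows "integrable lborel (\<lambda>t. Gamma (Complex c t))"
proof -
  obtain C where C: "C \<ge> 0"
    "\<And>z::complex. c \<le> Re z \<Longrightarrow> Re z \<le> c \<Longrightarrow> \<bar>Im z\<bar> \<ge> 1 \<Longrightarrow> norm (Gamma z) \<le> C / (Im z)\<^sup>2"
    using Gamma_vertical_decay[of c c] by blast
  show ?thesis
  proof (rule integrable_vertical_line)
    show "continuous_on {z. Re z = c} Gamma"
      using assms by (intro continuous_on_Gamma) (auto elim!: nonpos_Ints_cases')
  qed (use C in auto)
qed

text \<open>
  The factor \<open>\<Gamma>(b + B s) X\<^bsup>-s\<^esup>\<close> of the Mellin--Barnes integrand is brought to the form of the previous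
  theorem by the substitution \<open>s \<mapsto> (s - b) / B\<close>.
\<close>
lemma Cahen_Mellin_integral_affine:
  fixes b B \<kappa> X :: real
  assumes "B > 0" "b + B * \<kappa> > 0" "X > 0"
  shows "(LBINT t. Gamma (of_real b + of_real B * Complex \<kappa> t) * of_real X powr (- Complex \<kappa> t)) =
           of_real (2 * pi / B * X powr (b / B) * exp (- (X powr (1 / B))))"
proof -
  define c where "c = b + B * \<kappa>"
  define Y where "Y = X powr (1 / B)"
  have Y: "Y > 0" using assms by (simp add: Y_def)
  have integrand: "Gamma (of_real b + of_real B * Complex \<kappa> (0 + (1/B) * t)) *
                     of_real X powr (- Complex \<kappa> (0 + (1/B) * t)) =
                   of_real (X powr (b / B)) * (Gamma (Complex c t) * of_real Y powr (- Complex c t))" for t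
  proof -
    have arg: "of_real b + of_real B * Complex \<kappa> (0 + (1/B) * t) = Complex c t"
      using assms by (simp add: complex_eq_iff c_def)
    have "of_real Y powr (- Complex c t) = exp (- Complex c t * of_real (ln X / B))"
      using Y assms by (simp add: powr_def Ln_of_real Y_def ln_powr del: of_real_divide)
    moreover have "complex_of_real (X powr (b / B)) = exp (of_real (b * ln X / B))"
      using assms by (simp add: powr_def flip: exp_of_real)
    moreover have "of_real X powr (- Complex \<kappa> (0 + (1/B) * t)) =
        exp (- Complex \<kappa> (t / B) * of_real (ln X))"
      using assms by (simp add: powr_def Ln_of_real)
    moreover have "- Complex \<kappa> (t / B) * of_real (ln X) =
                     of_real (b * ln X / B) + - Complex c t * of_real (ln X / B)"
      using assms by (simp add: complex_eq_iff c_def field_simps)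
    ultimately have "of_real X powr (- Complex \<kappa> (0 + (1/B) * t)) =
        of_real (X powr (b / B)) * of_real Y powr (- Complex c t)"
      by (simp only: exp_add)
    thus ?thesis unfolding arg by (simp only: mult_ac)
  qed
  have "(LBINT t. Gamma (of_real b + of_real B * Complex \<kappa> t) * of_real X powr (- Complex \<kappa> t)) =
          \<bar>1 / B\<bar> *\<^sub>R (LBINT t. of_real (X powr (b / B)) *
            (Gamma (Complex c t) * of_real Y powr (- Complex c t)))"
    using assms by (subst lborel_integral_real_affine[where c = "1 / B" and t = 0])
      (simp_all only: integrand, simp)
  also have "\<dots> = of_real (2 * pi / B * X powr (b / B) * exp (- Y))"
    using Cahen_Mellin_integral[of c Y] assms Y by (simp add: c_def scaleR_conv_of_real)
  finally show ?thesis by (simp add: Y_def)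
qed

section \<open>The H-function as a real integral\<close>

text \<open>
  When the coefficient of \<open>s\<close> in the second Gamma factor is the negative of that in the third one, the
  product of these two factors is \<open>\<Gamma>(1 - a\<^sub>1 + b\<^sub>2)\<close> times a Beta function. Insert the Beta integral
  and exchange the two integrations: the remaining integral over the line is a Cahen--Mellin integral,
  taken at \<open>X = z e\<^bsup>Aw\<^esup>\<close>. The exchange is legitimate since the integrand factors in absolute value
  into a function of \<open>t\<close> and a function of \<open>w\<close>, each of them integrable.
\<close>
lemma H21_12_eq_log_integral:
  fixes a1 A b1 B1 b2 z \<kappa> :: real
  assumes pos: "A > 0" "B1 > 0" "z > 0"
    and sep: "H_separating \<kappa> a1 A b1 B1 b2 A"
  shows "H21_12 \<kappa> a1 A b1 B1 b2 A z =
           of_real (Gamma (1 - a1 + b2) / B1 *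
             (LBINT w. exp ((1 - a1) * w - (1 - a1 + b2) * ln (1 + exp w)) *
                ((z * exp (A * w)) powr (b1 / B1) * exp (- ((z * exp (A * w)) powr (1 / B1))))))"
proof -
  define p where "p = 1 - a1"
  have k: "b1 + B1 * \<kappa> > 0" "b2 + A * \<kappa> > 0" "p - A * \<kappa> > 0"
    using sep pos by (auto simp: H_separating_iff p_def field_simps)
  define s where "s = (\<lambda>t. Complex \<kappa> t)"
  define L where "L = (\<lambda>w::real. ln (1 + exp w))"
  define G where "G = (\<lambda>t. Gamma (of_real b1 + of_real B1 * s t) * of_real z powr (- s t))"
  define k where "k = (\<lambda>(t, w). G t * exp ((of_real p - of_real A * s t) * of_real w - of_real ((p + b2) * L w)))"
  have s_cont: "continuous_on UNIV s"
    unfolding s_def Complex_eq by (intro continuous_intros)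
  have "continuous_on {w. Re w > 0} (Gamma :: complex \<Rightarrow> complex)"
    by (intro continuous_on_Gamma) (auto elim!: nonpos_Ints_cases')
  hence "continuous_on UNIV (\<lambda>t. Gamma (of_real b1 + of_real B1 * s t))"
    by (rule continuous_on_compose2) (use k(1) in \<open>auto intro!: continuous_intros s_cont simp: s_def\<close>)
  hence G_cont: "continuous_on UNIV G"
    unfolding G_def using pos by (intro continuous_intros s_cont) auto
  have [measurable]: "G \<in> borel_measurable borel"
    by (rule borel_measurable_continuous_onI[OF G_cont])
  have [measurable]: "s \<in> borel_measurable borel"
    unfolding s_def Complex_eq by (intro borel_measurable_continuous_onI continuous_intros)
  have [measurable]: "L \<in> borel_measurable borel"
    unfolding L_def by measurable
  have [measurable]: "k \<in> borel_measurable (lborel \<Otimes>\<^sub>M lborel)"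
    unfolding k_def by measurable
  \<comment> \<open>integrating out \<open>w\<close> restores the second and the third Gamma factor\<close>
  have w_slice: "has_bochner_integral lborel (\<lambda>w. k (t, w))
      (H_integrand a1 A b1 B1 b2 A z (s t) / Gamma (of_real (p + b2)))" for t
  proof -
    let ?P = "of_real p - of_real A * s t" and ?Q = "of_real b2 + of_real A * s t"
    have sum: "?P + ?Q = of_real (p + b2)" by simp
    have "has_bochner_integral lborel (\<lambda>w. G t * exp (?P * of_real w - (?P + ?Q) * of_real (ln (1 + exp w))))
            (G t * Beta ?P ?Q)"
      using k by (intro has_bochner_integral_mult_right has_bochner_integral_Beta_exp)
        (simp_all add: s_def)
    moreover have "G t * Beta ?P ?Q = H_integrand a1 A b1 B1 b2 A z (s t) / Gamma (of_real (p + b2))"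
      unfolding Beta_def sum by (simp add: G_def H_integrand_def p_def)
    ultimately show ?thesis
      unfolding sum by (simp add: k_def L_def)
  qed
  \<comment> \<open>integrating out \<open>t\<close> turns the first Gamma factor into an exponential function\<close>
  have t_slice: "(LBINT t. k (t, w)) = of_real (2 * pi / B1 * (exp (p * w - (p + b2) * L w) *
      ((z * exp (A * w)) powr (b1 / B1) * exp (- ((z * exp (A * w)) powr (1 / B1))))))" for w
  proof -
    define X where "X = z * exp (A * w)"
    have X: "X > 0" using pos by (simp add: X_def)
    have "k (t, w) = of_real (exp (p * w - (p + b2) * L w)) *
           (Gamma (of_real b1 + of_real B1 * Complex \<kappa> t) * of_real X powr (- Complex \<kappa> t))" for t
    proof -
      have "of_real X powr (- s t) = of_real z powr (- s t) * exp (- (of_real A * s t * of_real w))"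
      proof -
        have "ln X = ln z + A * w" using pos by (simp add: X_def ln_mult)
        hence "of_real X powr (- s t) = exp (- s t * of_real (ln z + A * w))"
          using X by (simp add: powr_def Ln_of_real del: of_real_add)
        also have "\<dots> = of_real z powr (- s t) * exp (- (of_real A * s t * of_real w))"
          using pos by (simp add: powr_def Ln_of_real exp_add [symmetric] algebra_simps)
        finally show ?thesis .
      qed
      moreover have "exp ((of_real p - of_real A * s t) * of_real w - of_real ((p + b2) * L w)) =
          of_real (exp (p * w - (p + b2) * L w)) * exp (- (of_real A * s t * of_real w))"
        by (simp add: exp_of_real [symmetric] exp_add [symmetric] algebra_simps)
      ultimately show ?thesis
        unfolding k_def G_def by (simp add: s_def mult_ac)
    qed
    hence "(LBINT t. k (t, w)) = of_real (exp (p * w - (p + b2) * L w)) *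
        (LBINT t. Gamma (of_real b1 + of_real B1 * Complex \<kappa> t) * of_real X powr (- Complex \<kappa> t))"
      by (simp only: integral_mult_right_zero)
    also note Cahen_Mellin_integral_affine[OF pos(2) k(1) X]
    finally show ?thesis by (simp add: X_def mult_ac)
  qed
  have k_int: "integrable (lborel \<Otimes>\<^sub>M lborel) k"
  proof (rule lborel_pair.Fubini_integrable)
    define N where "N = (LBINT w. norm (exp ((of_real p - of_real A * of_real \<kappa>) * of_real w
                                          - of_real ((p + b2) * L w) :: complex)))"
    have "norm (k (t, w)) = norm (G t) * norm (exp ((of_real p - of_real A * of_real \<kappa>) * of_real w
                                          - of_real ((p + b2) * L w) :: complex))" for t w
      by (simp add: k_def norm_mult s_def)
    hence "(\<lambda>t. LBINT w. norm (k (t, w))) = (\<lambda>t. norm (G t) * N)"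
      by (simp add: N_def)
    moreover have "integrable lborel (\<lambda>t. norm (G t) * N)"
    proof -
      have "integrable lborel (\<lambda>t. Gamma (Complex (b1 + B1 * \<kappa>) (0 + B1 * t)))"
        using k(1) pos by (intro lborel_integrable_real_affine integrable_Gamma_vertical) auto
      also have "(\<lambda>t. Gamma (Complex (b1 + B1 * \<kappa>) (0 + B1 * t))) =
                 (\<lambda>t. Gamma (of_real b1 + of_real B1 * s t))"
        by (intro ext arg_cong[of _ _ Gamma]) (simp add: s_def complex_eq_iff)
      finally have "integrable lborel (\<lambda>t. norm (Gamma (of_real b1 + of_real B1 * s t)) * z powr (- \<kappa>) * N)"
        by (intro integrable_mult_left integrable_norm)
      moreover have "norm (G t) = norm (Gamma (of_real b1 + of_real B1 * s t)) * z powr (- \<kappa>)" for t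
        using pos by (simp add: G_def norm_mult norm_powr_real_powr s_def)
      ultimately show ?thesis by simp
    qed
    ultimately show "integrable lborel (\<lambda>t. LBINT w. norm (k (t, w)))" by simp
    show "AE t in lborel. integrable lborel (\<lambda>w. k (t, w))"
      using w_slice by (auto simp: has_bochner_integral_iff)
  qed measurable
  have "(LBINT t. LBINT w. k (t, w)) = (LBINT w. LBINT t. k (t, w))"
    using lborel_pair.Fubini_integral[of "\<lambda>t w. k (t, w)"] k_int by simp
  also have "(LBINT t. LBINT w. k (t, w)) =
               (LBINT t. H_integrand a1 A b1 B1 b2 A z (s t)) / Gamma (of_real (p + b2))"
    using w_slice by (simp add: has_bochner_integral_iff)
  finally have "(LBINT t. H_integrand a1 A b1 B1 b2 A z (s t)) / Gamma (of_real (p + b2)) =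
      of_real (2 * pi / B1 * (LBINT w. exp (p * w - (p + b2) * L w) *
      ((z * exp (A * w)) powr (b1 / B1) * exp (- ((z * exp (A * w)) powr (1 / B1))))))"
    by (simp only: t_slice integral_complex_of_real integral_mult_right_zero)
  moreover have "p + b2 > 0" using k(2,3) by linarith
  hence "Gamma (p + b2) \<noteq> 0" by (simp add: less_imp_neq[OF Gamma_real_pos, symmetric])
  ultimately have "(LBINT t. H_integrand a1 A b1 B1 b2 A z (s t)) =
      of_real (2 * pi * (Gamma (p + b2) / B1 * (LBINT w. exp (p * w - (p + b2) * L w) *
      ((z * exp (A * w)) powr (b1 / B1) * exp (- ((z * exp (A * w)) powr (1 / B1)))))))"
    by (simp add: Gamma_complex_of_real field_simps del: of_real_add)
  thus ?thesis
    unfolding H21_12_def by (simp add: s_def p_def L_def)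
qed

lemma set_integral_Ici_eq_Ioi:
  fixes f :: "real \<Rightarrow> 'a::euclidean_space"
  shows "(LBINT v:{0..}. f v) = (LBINT v:{0<..}. f v)"
  unfolding set_lebesgue_integral_def
  by (rule integral_discrete_difference[where X = "{0}"]) (auto simp: indicator_def)

lemma set_integral_Ici_exp_affine:
  fixes f :: "real \<Rightarrow> real"
  assumes f: "f \<in> borel_measurable borel" and "a > 0" "\<delta> > 0"
  shows "(LBINT v:{0..}. f v) =
           1 / \<delta> * (LBINT w. exp ((w - ln a) / \<delta>) * f (exp ((w - ln a) / \<delta>)))"
proof -
  have "(LBINT v:{0..}. f v) = (LBINT x. exp x * f (exp x))"
    using set_integral_Ioi_exp[OF f] by (simp add: set_integral_Ici_eq_Ioi)
  also have "\<dots> = \<bar>1 / \<delta>\<bar> *\<^sub>R (LBINT w. exp (- ln a / \<delta> + 1 / \<delta> * w) * f (exp (- ln a / \<delta> + 1 / \<delta> * w)))"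
    using assms by (intro lborel_integral_real_affine) auto
  also have "(\<lambda>w. - ln a / \<delta> + 1 / \<delta> * w) = (\<lambda>w. (w - ln a) / \<delta>)"
    by (auto simp: diff_divide_distrib)
  hence "(\<lambda>w. exp (- ln a / \<delta> + 1 / \<delta> * w) * f (exp (- ln a / \<delta> + 1 / \<delta> * w))) =
         (\<lambda>w. exp ((w - ln a) / \<delta>) * f (exp ((w - ln a) / \<delta>)))"
    by (simp add: fun_eq_iff)
  finally show ?thesis using assms by simp
qed

text \<open>
  The substitution \<open>a v\<^sup>\<delta> = e\<^sup>w\<close> undoes the logarithmic scale; it turns \<open>X = z e\<^bsup>w/\<delta>\<^esup>\<close> into \<open>b\<^bsup>1/\<rho>\<^esup> u v\<close>.
\<close>
lemma H21_12_eq_integral: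
  fixes \<alpha> \<beta> \<gamma> \<delta> \<rho> a b u \<kappa> :: real
  assumes pos: "\<delta> > 0" "\<rho> > 0" "a > 0" "b > 0" "u > 0"
    and sep: "H_separating \<kappa> (1 - (2 + \<alpha>) / \<delta>) (1 / \<delta>) (\<gamma> / \<rho>) (1 / \<rho>) (\<beta> - 1 / \<delta>) (1 / \<delta>)"
  shows "H21_12 \<kappa> (1 - (2 + \<alpha>) / \<delta>) (1 / \<delta>) (\<gamma> / \<rho>) (1 / \<rho>) (\<beta> - 1 / \<delta>) (1 / \<delta>)
           (b powr (1 / \<rho>) * u / a powr (1 / \<delta>)) =
         of_real (\<delta> * \<rho> * Gamma ((\<alpha> + 1) / \<delta> + \<beta>) * a powr ((2 + \<alpha>) / \<delta>) * b powr (\<gamma> / \<rho>) * u powr \<gamma> *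
           (LBINT v:{0..}. v powr (\<alpha> + \<gamma> + 1) *
              (1 + a * v powr \<delta>) powr (- ((\<alpha> + 1) / \<delta> + \<beta>)) * exp (- b * (u * v) powr \<rho>)))"
proof -
  define A where "A = (\<alpha> + 1) / \<delta> + \<beta>"
  define z where "z = b powr (1 / \<rho>) * u / a powr (1 / \<delta>)"
  define V where "V = (\<lambda>w. exp ((w - ln a) / \<delta>))"
  define f where "f = (\<lambda>v. v powr (\<alpha> + \<gamma> + 1) * (1 + a * v powr \<delta>) powr (- A) * exp (- b * (u * v) powr \<rho>))"
  have z: "z > 0" using pos by (simp add: z_def)
  have V_pos: "V w > 0" for w by (simp add: V_def)
  have args: "1 - (1 - (2 + \<alpha>) / \<delta>) = (2 + \<alpha>) / \<delta>"
    "(2 + \<alpha>) / \<delta> + (\<beta> - 1 / \<delta>) = A"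
    "\<gamma> / \<rho> / (1 / \<rho>) = \<gamma>" "1 / (1 / \<rho>) = \<rho>"
    using pos by (simp_all add: A_def field_simps)
  have [measurable]: "f \<in> borel_measurable borel" unfolding f_def by measurable
  have integrand: "exp ((2 + \<alpha>) / \<delta> * w - A * ln (1 + exp w)) *
           ((z * exp (1 / \<delta> * w)) powr \<gamma> * exp (- ((z * exp (1 / \<delta> * w)) powr \<rho>))) =
         a powr ((2 + \<alpha>) / \<delta>) * b powr (\<gamma> / \<rho>) * u powr \<gamma> * (V w * f (V w))" for w
  proof -
    have X: "z * exp (1 / \<delta> * w) = b powr (1 / \<rho>) * (u * V w)"
      using pos by (simp add: z_def V_def powr_def exp_diff diff_divide_distrib)
    have X\<rho>: "(z * exp (1 / \<delta> * w)) powr \<rho> = b * (u * V w) powr \<rho>"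
      unfolding X using pos V_pos[of w] by (simp add: powr_mult powr_powr)
    have X\<gamma>: "(z * exp (1 / \<delta> * w)) powr \<gamma> = b powr (\<gamma> / \<rho>) * u powr \<gamma> * V w powr \<gamma>"
      unfolding X using pos V_pos[of w] by (simp add: powr_mult powr_powr)
    have V\<delta>: "1 + a * V w powr \<delta> = 1 + exp w"
      using pos by (simp add: V_def powr_def exp_diff)
    have "exp ((2 + \<alpha>) / \<delta> * w) = a powr ((2 + \<alpha>) / \<delta>) * V w powr (2 + \<alpha>)"
      using pos by (simp add: V_def powr_def flip: exp_add) (simp add: field_simps)
    moreover have "exp (- (A * ln (1 + exp w))) = (1 + exp w) powr (- A)"
      by (simp add: powr_def add_pos_pos less_imp_neq[symmetric])
    ultimately have E: "exp ((2 + \<alpha>) / \<delta> * w - A * ln (1 + exp w)) =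
        a powr ((2 + \<alpha>) / \<delta>) * V w powr (2 + \<alpha>) * (1 + exp w) powr (- A)"
      by (metis exp_add uminus_add_conv_diff add.commute)
    have "V w * V w powr (\<alpha> + \<gamma> + 1) = V w powr (2 + \<alpha>) * V w powr \<gamma>"
      using V_pos[of w] powr_add[of "V w" 1 "\<alpha> + \<gamma> + 1"] powr_add[of "V w" "2 + \<alpha>" \<gamma>] by (simp add: add_ac)
    thus ?thesis
      unfolding E X\<rho> X\<gamma> f_def V\<delta> by (simp add: mult_ac)
  qed
  have "H21_12 \<kappa> (1 - (2 + \<alpha>) / \<delta>) (1 / \<delta>) (\<gamma> / \<rho>) (1 / \<rho>) (\<beta> - 1 / \<delta>) (1 / \<delta>) z =
          of_real (Gamma A / (1 / \<rho>) * (LBINT w. a powr ((2 + \<alpha>) / \<delta>) * b powr (\<gamma> / \<rho>) * u powr \<gamma> *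
            (V w * f (V w))))"
    using H21_12_eq_log_integral[OF _ _ z sep, unfolded args integrand] pos by simp
  also have "(LBINT w. a powr ((2 + \<alpha>) / \<delta>) * b powr (\<gamma> / \<rho>) * u powr \<gamma> * (V w * f (V w))) =
               a powr ((2 + \<alpha>) / \<delta>) * b powr (\<gamma> / \<rho>) * u powr \<gamma> * (\<delta> * (LBINT v:{0..}. f v))"
    using set_integral_Ici_exp_affine[of f a \<delta>] pos by (simp add: V_def)
  finally show ?thesis
    by (simp add: z_def f_def A_def mult_ac)
qed

section \<open>The H-function as a sum of two confluent hypergeometric series\<close>

text \<open>
  This is where the denominator parameters of \<open>\<^sub>1F\<^sub>1\<close> come from: at the poles of one Gamma factor the
  arguments of the other one differ by integers.
\<close>
lemma Gamma_minus_of_nat: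
  fixes z :: real
  assumes "z \<notin> \<int>"
  shows "Gamma (z - of_nat k) = (-1) ^ k * Gamma z / pochhammer (1 - z) k"
proof (induction k)
  case (Suc k)
  have ne: "z - of_nat k - 1 \<noteq> 0"
  proof
    assume "z - of_nat k - 1 = 0"
    hence "z = of_int (int k + 1)" by simp
    thus False using assms by (metis Ints_of_int)
  qed
  have "Gamma (z - of_nat k) = (z - of_nat k - 1) * Gamma (z - of_nat (Suc k))"
    using Gamma_eq_minus1[of "z - of_nat k"] ne by (simp add: algebra_simps)
  hence "Gamma (z - of_nat (Suc k)) = Gamma (z - of_nat k) / (z - of_nat k - 1)"
    using ne by (simp add: field_simps)
  also have "\<dots> = (-1) ^ Suc k * Gamma z / (pochhammer (1 - z) k * (1 - z + of_nat k))"
    unfolding Suc.IH using ne by (simp add: divide_simps) (simp add: algebra_simps)?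
  finally show ?case by (simp add: pochhammer_Suc)
qed auto

lemma confluent_1F1_sums:
  fixes a c z :: real
  assumes "c \<notin> \<int>\<^sub>\<le>\<^sub>0"
  shows "(\<lambda>k. pochhammer a k / pochhammer c k * z ^ k / fact k) sums confluent_1F1 a c z"
proof -
  define f where "f = (\<lambda>k. pochhammer a k / pochhammer c k * z ^ k / fact k)"
  define q where "q = (\<lambda>k. (a + real k) / (c + real k) * z / (real k + 1))"
  have ne: "c + real k \<noteq> 0" for k
    using assms by (metis add.commute add_eq_0_iff minus_of_nat_in_nonpos_Ints)
  have step: "f (Suc k) = q k * f k" for k
    using ne[of k] by (simp add: f_def q_def pochhammer_Suc field_simps)
  have "q \<longlonglongrightarrow> 0"
    unfolding q_def by real_asymp
  hence "(\<lambda>k. norm (q k)) \<longlonglongrightarrow> 0" by (rule tendsto_norm_zero)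
  hence "\<forall>\<^sub>F k in sequentially. norm (q k) < 1/2"
    by (rule order_tendstoD) simp
  then obtain N where N: "\<And>k. k \<ge> N \<Longrightarrow> norm (q k) < 1/2"
    by (auto simp: eventually_at_top_linorder)
  have "summable f"
  proof (rule summable_ratio_test[of "1/2" N])
    fix k assume "k \<ge> N"
    thus "norm (f (Suc k)) \<le> 1/2 * norm (f k)"
      unfolding step norm_mult using N[of k] by (intro mult_right_mono) auto
  qed simp
  thus ?thesis
    unfolding confluent_1F1_altdef f_def by (rule summable_sums)
qed

text \<open>
  The residues at the poles of the first Gamma factor are, up to a common constant, the terms of a
  \<open>\<^sub>1F\<^sub>1\<close> series. Since \<open>a - b\<close> is not an integer, the second factor is regular there and the pole is simple.
\<close>
lemma residue_Gamma_product:
  fixes a b r x :: real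
  assumes "a - b \<notin> \<int>" "r + a > 0" "x > 0"
  shows "residue (\<lambda>s. Gamma (of_real a + s) * Gamma (of_real b + s) * Gamma (of_real r - s) *
                    of_real x powr (- s)) (- of_real a - of_nat k) =
         of_real (x powr a * Gamma (b - a) * Gamma (r + a) *
           (pochhammer (r + a) k / pochhammer (1 + a - b) k * x ^ k / fact k))"
proof -
  let ?p = "- of_real a - of_nat k :: complex"
  define G :: "complex \<Rightarrow> complex"
    where "G = (\<lambda>s. Gamma (of_real b + s) * (Gamma (of_real r - s) * of_real x powr (- s)))"
  define S where "S = (\<lambda>s. of_real b + s) -` (- \<int>\<^sub>\<le>\<^sub>0) \<inter> {s::complex. Re s < r}"
  have notint: "b - a \<notin> \<int>" "b - a - real k \<notin> \<int>"
  proof -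
    show 1: "b - a \<notin> \<int>" using assms(1) Ints_minus[of "b - a"] by auto
    show "b - a - real k \<notin> \<int>" using 1 Ints_add[of "b - a - real k" "real k"] by auto
  qed
  have "open S" unfolding S_def
    by (intro open_Int open_vimage open_halfspace_Re_lt continuous_intros open_Compl closed_nonpos_Ints)
  moreover have eq: "of_real b + ?p = of_real (b - a - real k)" by simp
  have "of_real b + ?p \<notin> \<int>\<^sub>\<le>\<^sub>0"
    unfolding eq using notint nonpos_Ints_subset_Ints
    by (auto simp: of_real_in_nonpos_Ints_iff simp del: of_real_diff)
  hence "?p \<in> S" using assms by (auto simp: S_def)
  moreover have "G holomorphic_on S"
    unfolding G_def using assms
    by (intro holomorphic_intros) (auto simp: S_def intro!: Re_pos_notin_nonpos_Ints)
  ultimately have "residue (\<lambda>s. Gamma (of_real a + s) * G s) ?p = (-1) ^ k / fact k * G ?p"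
    by (rule residue_Gamma_shift_mult)
  also have "G ?p = of_real (Gamma (b - a - real k) * (Gamma (r + a + real k) * x powr (a + real k)))"
  proof -
    have "of_real r - ?p = of_real (r + a + real k)" by simp
    moreover have "of_real x powr (- ?p) = of_real (x powr (a + real k))"
      using assms powr_of_real[of x "a + real k"] by (simp add: add.commute)
    ultimately show ?thesis unfolding G_def eq
      by (simp only: Gamma_complex_of_real of_real_mult)
  qed
  also have "Gamma (b - a - real k) = (-1) ^ k * Gamma (b - a) / pochhammer (1 + a - b) k"
    using Gamma_minus_of_nat[OF notint(1), of k] by (simp add: algebra_simps)
  also have "Gamma (r + a + real k) = Gamma (r + a) * pochhammer (r + a) k"
  proof -
    have "r + a \<notin> \<int>\<^sub>\<le>\<^sub>0" using assms(2) by (auto elim!: nonpos_Ints_cases')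
    moreover from this have "Gamma (r + a) \<noteq> 0" by (simp add: Gamma_eq_zero_iff)
    ultimately show ?thesis using pochhammer_Gamma[of "r + a" k] by simp
  qed
  also have "x powr (a + real k) = x powr a * x ^ k"
    using assms by (simp add: powr_add powr_realpow)
  finally show ?thesis
    by (simp add: G_def mult_ac flip: power_mult_distrib)
qed

text \<open>
  The poles of one family to the right of the line \<open>Re z = \<sigma> - n\<close> form an initial segment of this kind.
\<close>
lemma partial_sums_ceiling_tendsto:
  fixes f :: "nat \<Rightarrow> complex" and c :: real
  assumes "f sums l"
  shows "(\<lambda>n. \<Sum>k\<in>{k. real k < real n + c}. f k) \<longlonglongrightarrow> l"
proof -
  have "filterlim (\<lambda>n. nat \<lceil>real n + c\<rceil>) at_top sequentially"
    by real_asymp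
  hence "(\<lambda>n. \<Sum>k<nat \<lceil>real n + c\<rceil>. f k) \<longlonglongrightarrow> l"
    using assms unfolding sums_def by (rule filterlim_compose[rotated])
  moreover have "{k. real k < real n + c} = {..<nat \<lceil>real n + c\<rceil>}" for n
    by (auto simp: less_ceiling_iff zless_nat_eq_int_zless)
  ultimately show ?thesis by simp
qed

text \<open>
  Each of the two families of poles on the left contributes one series. For a shift of the line by one
  to the left the functional equation contributes the factor \<open>x (r - z) / ((a + z - 1) (b + z - 1))\<close>.
  One linear factor of the denominator compensates \<open>r - z\<close>, and the other one makes the factor tend
  to \<open>0\<close> for every \<open>x\<close>.
\<close>
lemma Gamma_product_integral_1F1:
  fixes a b r x \<kappa> :: real
  assumes nonint: "a - b \<notin> \<int>" and \<kappa>: "- a < \<kappa>" "- b < \<kappa>" "\<kappa> < r" and x: "x > 0"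
  shows "(LBINT t. Gamma (of_real a + Complex \<kappa> t) * Gamma (of_real b + Complex \<kappa> t) *
            Gamma (of_real r - Complex \<kappa> t) * of_real x powr (- Complex \<kappa> t)) =
         of_real (2 * pi *
           (x powr a * Gamma (b - a) * Gamma (r + a) * confluent_1F1 (r + a) (1 + a - b) x +
            x powr b * Gamma (a - b) * Gamma (r + b) * confluent_1F1 (r + b) (1 + b - a) x))"
proof -
  define F :: "complex \<Rightarrow> complex"
    where "F = (\<lambda>s. Gamma (of_real a + s) * Gamma (of_real b + s) * Gamma (of_real r - s) *
                    of_real x powr (- s))"
  define T :: "real \<Rightarrow> real \<Rightarrow> nat \<Rightarrow> complex"
    where "T = (\<lambda>a b k. of_real (x powr a * Gamma (b - a) * Gamma (r + a) *
           (pochhammer (r + a) k / pochhammer (1 + a - b) k * x ^ k / fact k)))"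
  define Pa Pb :: "complex set"
    where "Pa = range (\<lambda>k. - of_real a - of_nat k)" and "Pb = range (\<lambda>k. - of_real b - of_nat k)"
  define d where "d = frac (a - b)"
  have d: "0 < d" "d < 1" using nonint by (auto simp: d_def frac_gt_0_iff frac_lt_1)
  have d_ne: "d \<noteq> 2 * real_of_int m" for m
  proof
    assume "d = 2 * real_of_int m"
    with d have "0 < real_of_int m" "real_of_int m < 1" by linarith+
    thus False by simp
  qed
  have d_eq: "a - b = of_int \<lfloor>a - b\<rfloor> + d" by (simp add: d_def frac_def)
  have nonint': "b - a \<notin> \<int>" using nonint Ints_minus[of "b - a"] by auto
  \<comment> \<open>the lines \<open>Re z = \<sigma> - n\<close> must avoid both families \<open>-a - k\<close> and \<open>-b - k\<close>: modulo \<open>1\<close>, \<open>\<sigma>\<close> lies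
    halfway from \<open>-a\<close> up to the next translate of \<open>-b\<close>\<close>
  define \<sigma> where "\<sigma> = - a + d / 2 - 1"
  have avoid_a: "- a - real k \<noteq> \<sigma> - real n" for k n
  proof
    assume "- a - real k = \<sigma> - real n"
    hence "d = 2 * real_of_int (1 + int n - int k)" by (simp add: \<sigma>_def)
    thus False using d_ne by blast
  qed
  have avoid_b: "- b - real k \<noteq> \<sigma> - real n" for k n
  proof
    assume "- b - real k = \<sigma> - real n"
    hence "d = 2 * real_of_int (int k - int n - 1 - \<lfloor>a - b\<rfloor>)" using d_eq by (simp add: \<sigma>_def)
    thus False using d_ne by blast
  qed
  have mem_Pa: "z \<in> Pa \<longleftrightarrow> of_real a + z \<in> \<int>\<^sub>\<le>\<^sub>0" for z
    unfolding Pa_def by (auto elim!: nonpos_Ints_cases' simp: image_iff) (metis add_diff_cancel_left' minus_diff_commute)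
  have mem_Pb: "z \<in> Pb \<longleftrightarrow> of_real b + z \<in> \<int>\<^sub>\<le>\<^sub>0" for z
    unfolding Pb_def by (auto elim!: nonpos_Ints_cases' simp: image_iff) (metis add_diff_cancel_left' minus_diff_commute)
  define \<epsilon> where "\<epsilon> = (\<lambda>n. x * (1 + \<bar>r + b - 1\<bar> / \<bar>b + \<sigma> - 1 - real n\<bar>) / \<bar>a + \<sigma> - 1 - real n\<bar>)"
  have "(\<lambda>n. \<Sum>p\<in>{p\<in>Pa \<union> Pb. \<sigma> - real n < Re p \<and> Re p < \<kappa>}. residue F p)
          \<longlonglongrightarrow> (LBINT t. F (Complex \<kappa> t)) / (2 * of_real pi)"
  proof (rule vertical_integral_residue_series[where R = r and \<epsilon> = \<epsilon>])
    show "\<sigma> < \<kappa>" using d \<kappa> by (simp add: \<sigma>_def)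
    show "Pa \<union> Pb \<subseteq> \<real>" by (auto simp: Pa_def Pb_def)
    show "finite {p\<in>Pa \<union> Pb. L < Re p}" for L
    proof (rule finite_subset)
      show "{p\<in>Pa \<union> Pb. L < Re p} \<subseteq>
              (\<lambda>k. - of_real a - of_nat k) ` {..nat \<lceil>- L - a\<rceil>} \<union>
              (\<lambda>k. - of_real b - of_nat k) ` {..nat \<lceil>- L - b\<rceil>}"
        unfolding Pa_def Pb_def by (auto intro!: imageI simp: le_nat_iff image_iff) linarith+
    qed simp
    show "Re p \<noteq> \<kappa>" if "p \<in> Pa \<union> Pb" for p
      using that \<kappa> by (auto simp: Pa_def Pb_def)
    show "Re p \<noteq> \<sigma> - real n" if "p \<in> Pa \<union> Pb" for p n
      using that avoid_a avoid_b by (auto simp: Pa_def Pb_def)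
    show "F holomorphic_on {z. Re z < r} - (Pa \<union> Pb)"
      unfolding F_def using x
      by (intro holomorphic_intros) 
         (auto simp: mem_Pa mem_Pb intro!: Re_pos_notin_nonpos_Ints)
    show "\<exists>C. \<forall>z. l \<le> Re z \<and> Re z \<le> \<kappa> \<and> \<bar>Im z\<bar> \<ge> 1 \<longrightarrow> norm (F z) \<le> C / (Im z)\<^sup>2" for l
    proof -
      \<comment> \<open>one Gamma factor supplies the quadratic decay, the others are bounded\<close>
      have bounded: "\<exists>C\<ge>0. \<forall>z::complex. u \<le> Re z \<and> Re z \<le> v \<and> \<bar>Im z\<bar> \<ge> 1 \<longrightarrow>
                       norm (Gamma z) \<le> C / (Im z)\<^sup>2 \<and> norm (Gamma z) \<le> C" for u v
      proof -
        obtain C where C: "C \<ge> 0"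
          "\<And>z::complex. u \<le> Re z \<Longrightarrow> Re z \<le> v \<Longrightarrow> \<bar>Im z\<bar> \<ge> 1 \<Longrightarrow> norm (Gamma z) \<le> C / (Im z)\<^sup>2"
          using Gamma_vertical_decay[of u v] by blast
        have "C / (Im z)\<^sup>2 \<le> C" if "\<bar>Im z\<bar> \<ge> 1" for z
          using C(1) one_le_power[OF that, of 2] that by (auto simp: divide_le_eq mult_le_cancel_left1)
        thus ?thesis using C by (meson order.trans)
      qed
      obtain C1 where C1: "C1 \<ge> 0" "\<And>z::complex. a + l \<le> Re z \<Longrightarrow> Re z \<le> a + \<kappa> \<Longrightarrow> \<bar>Im z\<bar> \<ge> 1 \<Longrightarrow> norm (Gamma z) \<le> C1 / (Im z)\<^sup>2"
        using bounded[of "a + l" "a + \<kappa>"] by blast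
      obtain C2 where C2: "C2 \<ge> 0" "\<And>z::complex. b + l \<le> Re z \<Longrightarrow> Re z \<le> b + \<kappa> \<Longrightarrow> \<bar>Im z\<bar> \<ge> 1 \<Longrightarrow> norm (Gamma z) \<le> C2"
        using bounded[of "b + l" "b + \<kappa>"] by blast
      obtain C3 where C3: "C3 \<ge> 0" "\<And>z::complex. r - \<kappa> \<le> Re z \<Longrightarrow> Re z \<le> r - l \<Longrightarrow> \<bar>Im z\<bar> \<ge> 1 \<Longrightarrow> norm (Gamma z) \<le> C3"
        using bounded[of "r - \<kappa>" "r - l"] by blast
      have "norm (F z) \<le> C1 * C2 * C3 * (x powr (- l) + x powr (- \<kappa>)) / (Im z)\<^sup>2"
        if z: "l \<le> Re z" "Re z \<le> \<kappa>" "\<bar>Im z\<bar> \<ge> 1" for z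
      proof -
        have "norm (F z) \<le> C1 / (Im z)\<^sup>2 * C2 * C3 * (x powr (- l) + x powr (- \<kappa>))"
          unfolding F_def norm_mult
          using C1(1) C2(1) C3(1) C1(2)[of "of_real a + z"] C2(2)[of "of_real b + z"]
            C3(2)[of "of_real r - z"] norm_powr_strip_le[OF x z(1,2)] z
          by (intro mult_mono mult_nonneg_nonneg) auto
        thus ?thesis by simp
      qed
      thus ?thesis by blast
    qed
    show "norm (F (z - 1)) \<le> \<epsilon> n * norm (F z)" if z: "Re z = \<sigma> - real n" for n z
    proof -
      have za: "\<bar>a + \<sigma> - 1 - real n\<bar> \<le> norm (of_real a + z - 1)"
        using abs_Re_le_cmod[of "of_real a + z - 1"] z by (simp add: algebra_simps)
      have zb: "\<bar>b + \<sigma> - 1 - real n\<bar> \<le> norm (of_real b + z - 1)"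
        using abs_Re_le_cmod[of "of_real b + z - 1"] z by (simp add: algebra_simps)
      have a0: "\<bar>a + \<sigma> - 1 - real n\<bar> > 0" using avoid_a[of 0 "Suc n"] by simp
      have b0: "\<bar>b + \<sigma> - 1 - real n\<bar> > 0" using avoid_b[of 0 "Suc n"] by simp
      have ne: "of_real a + z - 1 \<noteq> 0" "of_real b + z - 1 \<noteq> 0"
        using za zb a0 b0 by auto
      have Ga: "Gamma (of_real a + z) = (of_real a + z - 1) * Gamma (of_real a + (z - 1))"
        using Gamma_eq_minus1[of "of_real a + z"] ne by (simp add: algebra_simps)
      have Gb: "Gamma (of_real b + z) = (of_real b + z - 1) * Gamma (of_real b + (z - 1))"
        using Gamma_eq_minus1[of "of_real b + z"] ne by (simp add: algebra_simps)
      have "Re (of_real r - z) > 0" using z d \<kappa> by (simp add: \<sigma>_def)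
      hence "of_real r - z \<notin> \<int>\<^sub>\<le>\<^sub>0" by (rule Re_pos_notin_nonpos_Ints)
      hence Gr: "Gamma (of_real r - (z - 1)) = (of_real r - z) * Gamma (of_real r - z)"
        using Gamma_plus1[of "of_real r - z"] by (simp add: algebra_simps)
      have px: "of_real x powr (- (z - 1)) = of_real x * of_real x powr (- z)"
        using powr_add[of "complex_of_real x" 1 "- z"] x by simp
      have cancel: "f = w / (v' * v) * g"
        if "v * v' * f = w * g" "v \<noteq> 0" "v' \<noteq> 0" for v v' w f g :: complex
        using that by (simp add: field_simps)
      have "F (z - 1) = of_real x * (of_real r - z) / ((of_real b + z - 1) * (of_real a + z - 1)) * F z"
      proof (rule cancel)
        show "(of_real a + z - 1) * (of_real b + z - 1) * F (z - 1) = of_real x * (of_real r - z) * F z"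
          unfolding F_def Ga Gb Gr px by (simp only: mult_ac)
      qed (rule ne)+
      hence "norm (F (z - 1)) = x * (norm (of_real r - z) / norm (of_real b + z - 1)) /
                norm (of_real a + z - 1) * norm (F z)"
        using x by (simp add: norm_mult norm_divide)
      also have "\<dots> \<le> \<epsilon> n * norm (F z)"
        unfolding \<epsilon>_def
      proof (intro mult_right_mono frac_le mult_left_mono za a0)
        have "norm (of_real r - z) = norm (of_real (r + b - 1) - (of_real b + z - 1))"
          by simp
        also have "\<dots> \<le> norm (of_real (r + b - 1) :: complex) + norm (of_real b + z - 1)"
          by (rule norm_triangle_ineq4)
        finally have "norm (of_real r - z) / norm (of_real b + z - 1) \<le>
            (\<bar>r + b - 1\<bar> + norm (of_real b + z - 1)) / norm (of_real b + z - 1)"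
          by (intro divide_right_mono) (simp_all only: norm_of_real norm_ge_zero)
        also have "\<dots> = 1 + \<bar>r + b - 1\<bar> / norm (of_real b + z - 1)"
          using ne by (simp add: field_simps)
        also have "\<dots> \<le> 1 + \<bar>r + b - 1\<bar> / \<bar>b + \<sigma> - 1 - real n\<bar>"
          using zb b0 by (intro add_left_mono frac_le) auto
        finally show "norm (of_real r - z) / norm (of_real b + z - 1) \<le>
            1 + \<bar>r + b - 1\<bar> / \<bar>b + \<sigma> - 1 - real n\<bar>" .
      qed (use x in auto)
      finally show ?thesis .
    qed
    show "\<epsilon> \<longlonglongrightarrow> 0"
    proof -
      define v where "v = \<bar>r + b - 1\<bar>"
      show ?thesis unfolding \<epsilon>_def v_def [symmetric] by real_asymp
    qed
  qed (use \<kappa> in auto)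
  moreover have "(\<Sum>p\<in>{p\<in>Pa \<union> Pb. \<sigma> - real n < Re p \<and> Re p < \<kappa>}. residue F p) =
      (\<Sum>k\<in>{k. real k < real n + (- \<sigma> - a)}. T a b k) +
      (\<Sum>k\<in>{k. real k < real n + (- \<sigma> - b)}. T b a k)" for n
  proof -
    let ?Ka = "{k. real k < real n + (- \<sigma> - a)}" and ?Kb = "{k. real k < real n + (- \<sigma> - b)}"
    have fin: "finite {k. real k < real n + u}" for u
      by (rule finite_subset[of _ "{..nat \<lceil>real n + u\<rceil>}"]) (auto simp: le_nat_iff, linarith)
    have set_eq: "{p\<in>Pa \<union> Pb. \<sigma> - real n < Re p \<and> Re p < \<kappa>} =
            (\<lambda>k. - of_real a - of_nat k) ` ?Ka \<union> (\<lambda>k. - of_real b - of_nat k) ` ?Kb"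
      using \<kappa> by (auto simp: Pa_def Pb_def)
    have disj: "(\<lambda>k. - of_real a - of_nat k :: complex) ` ?Ka \<inter> (\<lambda>k. - of_real b - of_nat k) ` ?Kb = {}"
    proof -
      have "- of_real a - of_nat k \<noteq> (- of_real b - of_nat m :: complex)" for k m
      proof
        assume "- of_real a - of_nat k = (- of_real b - of_nat m :: complex)"
        hence "a - b = of_int (int m - int k)" by (auto dest!: arg_cong[of _ _ Re])
        thus False using nonint by (metis Ints_of_int)
      qed
      thus ?thesis by auto
    qed
    have "residue F (- of_real a - of_nat k) = T a b k" for k
      unfolding F_def T_def using nonint \<kappa> x by (intro residue_Gamma_product) auto
    moreover have "residue F (- of_real b - of_nat k) = T b a k" for k
      using residue_Gamma_product[of b a r x k] nonint' \<kappa> x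
      unfolding F_def T_def by (simp add: mult_ac)
    ultimately show ?thesis
      unfolding set_eq using fin disj
      by (subst sum.union_disjoint) (simp_all add: sum.reindex inj_on_def)
  qed
  moreover have T_sums: "T a' b' sums of_real (x powr a' * Gamma (b' - a') * Gamma (r + a') *
                       confluent_1F1 (r + a') (1 + a' - b') x)" if "a' - b' \<notin> \<int>" for a' b'
  proof -
    have "1 + a' - b' \<notin> \<int>\<^sub>\<le>\<^sub>0"
    proof
      assume "1 + a' - b' \<in> \<int>\<^sub>\<le>\<^sub>0"
      hence "1 + a' - b' \<in> \<int>" using nonpos_Ints_subset_Ints by blast
      from Ints_diff[OF this Ints_1] that show False by simp
    qed
    thus ?thesis unfolding T_def by (intro sums_of_real sums_mult confluent_1F1_sums)
  qed
  have "(\<lambda>n. (\<Sum>k\<in>{k. real k < real n + (- \<sigma> - a)}. T a b k) +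
      (\<Sum>k\<in>{k. real k < real n + (- \<sigma> - b)}. T b a k)) \<longlonglongrightarrow>
      of_real (x powr a * Gamma (b - a) * Gamma (r + a) * confluent_1F1 (r + a) (1 + a - b) x) +
      of_real (x powr b * Gamma (a - b) * Gamma (r + b) * confluent_1F1 (r + b) (1 + b - a) x)"
    by (intro tendsto_add partial_sums_ceiling_tendsto T_sums nonint nonint')
  ultimately have "(LBINT t. F (Complex \<kappa> t)) / (2 * of_real pi) =
      of_real (x powr a * Gamma (b - a) * Gamma (r + a) * confluent_1F1 (r + a) (1 + a - b) x) +
      of_real (x powr b * Gamma (a - b) * Gamma (r + b) * confluent_1F1 (r + b) (1 + b - a) x)"
    by (simp only:) (rule LIMSEQ_unique)
  thus ?thesis unfolding F_def by (simp add: field_simps)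
qed

text \<open>
  When all three coefficients of \<open>s\<close> agree up to sign, taking \<open>A s\<close> as the new variable reduces the
  integral to the preceding one with \<open>x = z\<^bsup>1/A\<^esup>\<close>.
\<close>
lemma H21_12_eq_1F1:
  fixes A a1 b1 b2 z \<kappa> :: real
  assumes pos: "A > 0" "z > 0" and sep: "H_separating \<kappa> a1 A b1 A b2 A"
    and nonint: "b1 - b2 \<notin> \<int>"
  shows "H21_12 \<kappa> a1 A b1 A b2 A z = of_real (1 / A *
           (Gamma (b2 - b1) * Gamma (1 - a1 + b1) * z powr (b1 / A) *
              confluent_1F1 (1 - a1 + b1) (1 + b1 - b2) (z powr (1 / A)) +
            Gamma (b1 - b2) * Gamma (1 - a1 + b2) * z powr (b2 / A) *
              confluent_1F1 (1 - a1 + b2) (1 + b2 - b1) (z powr (1 / A))))"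
proof -
  define x where "x = z powr (1 / A)"
  have x: "x > 0" using pos by (simp add: x_def)
  have \<kappa>: "- b1 < A * \<kappa>" "- b2 < A * \<kappa>" "A * \<kappa> < 1 - a1"
    using sep pos by (auto simp: H_separating_iff field_simps)
  have integrand: "H_integrand a1 A b1 A b2 A z (Complex \<kappa> (0 + 1 / A * t)) =
      Gamma (of_real b1 + Complex (A * \<kappa>) t) * Gamma (of_real b2 + Complex (A * \<kappa>) t) *
      Gamma (of_real (1 - a1) - Complex (A * \<kappa>) t) * of_real x powr (- Complex (A * \<kappa>) t)" for t
  proof -
    have s: "of_real A * Complex \<kappa> (0 + 1 / A * t) = Complex (A * \<kappa>) t"
      using pos by (simp add: complex_eq_iff)
    have "of_real x powr (- Complex (A * \<kappa>) t) = exp (- Complex (A * \<kappa>) t * of_real (ln z / A))"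
      using x pos by (simp add: powr_def Ln_of_real x_def ln_powr del: of_real_divide)
    also have "- Complex (A * \<kappa>) t * of_real (ln z / A) = - Complex \<kappa> (0 + 1 / A * t) * of_real (ln z)"
      using pos by (simp add: complex_eq_iff)
    also have "exp \<dots> = of_real z powr (- Complex \<kappa> (0 + 1 / A * t))"
      using pos by (simp add: powr_def Ln_of_real)
    finally show ?thesis
      unfolding H_integrand_def s by simp
  qed
  have "(LBINT t. H_integrand a1 A b1 A b2 A z (Complex \<kappa> t)) =
          \<bar>1 / A\<bar> *\<^sub>R (LBINT t. H_integrand a1 A b1 A b2 A z (Complex \<kappa> (0 + 1 / A * t)))"
    using pos by (intro lborel_integral_real_affine) auto
  also have "(LBINT t. H_integrand a1 A b1 A b2 A z (Complex \<kappa> (0 + 1 / A * t))) =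
       of_real (2 * pi *
           (x powr b1 * Gamma (b2 - b1) * Gamma (1 - a1 + b1) * confluent_1F1 (1 - a1 + b1) (1 + b1 - b2) x +
            x powr b2 * Gamma (b1 - b2) * Gamma (1 - a1 + b2) * confluent_1F1 (1 - a1 + b2) (1 + b2 - b1) x))"
    unfolding integrand by (rule Gamma_product_integral_1F1[OF nonint \<kappa> x])
  finally have "H21_12 \<kappa> a1 A b1 A b2 A z = of_real (1 / A *
           (x powr b1 * Gamma (b2 - b1) * Gamma (1 - a1 + b1) * confluent_1F1 (1 - a1 + b1) (1 + b1 - b2) x +
            x powr b2 * Gamma (b1 - b2) * Gamma (1 - a1 + b2) * confluent_1F1 (1 - a1 + b2) (1 + b2 - b1) x))"
    using pos by (simp add: H21_12_def scaleR_conv_of_real)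
  moreover have "x powr b = z powr (b / A)" for b
    using pos by (simp add: x_def powr_powr)
  ultimately show ?thesis by (simp add: x_def mult_ac)
qed

section \<open>The density of the ratio\<close>

text \<open>
  At \<open>u = 0\<close> every expression in the theorem vanishes because of the convention \<open>0 powr w = 0\<close>.
\<close>
lemma H21_12_zero: "H21_12 \<kappa> a1 A1 b1 B1 b2 B2 0 = 0"
  by (simp add: H21_12_def H_integrand_def)

theorem theorem3p7:
  fixes \<alpha> \<beta> \<gamma> \<delta> \<rho> a b c c1 :: real and f1 f2 g2 :: "real \<Rightarrow> real"
  assumes "\<alpha> > -1" and "\<gamma> > -1" and "\<delta> > 0" and "\<rho> > 0" and "a > 0" and "b > 0" and "\<beta> > 0"
    and f1: "f1 = (\<lambda>x. if x \<ge> 0 then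
               \<delta> * a powr ((\<alpha> + 1) / \<delta>) * Gamma ((\<alpha> + 1) / \<delta> + \<beta>) /
                 (Gamma ((\<alpha> + 1) / \<delta>) * Gamma \<beta>) *
               x powr \<alpha> * (1 + a * x powr \<delta>) powr (- ((\<alpha> + 1) / \<delta> + \<beta>)) else 0)"
    and f2: "f2 = (\<lambda>x. if x \<ge> 0 then
               \<rho> * b powr ((\<gamma> + 1) / \<rho>) / Gamma ((\<gamma> + 1) / \<rho>) *
               x powr \<gamma> * exp (- b * x powr \<rho>) else 0)"
    and g2: "g2 = (\<lambda>u. LBINT v:{0..}. v * f1 v * f2 (u * v))"
    and c: "c = \<delta> * \<rho> * a powr ((\<alpha> + 1) / \<delta>) * b powr ((\<gamma> + 1) / \<rho>) * Gamma ((\<alpha> + 1) / \<delta> + \<beta>) /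
               (Gamma ((\<alpha> + 1) / \<delta>) * Gamma \<beta> * Gamma ((\<gamma> + 1) / \<rho>))"
    and c1: "c1 = b powr (1 / \<rho>) /
               (a powr (1 / \<delta>) * Gamma ((\<alpha> + 1) / \<delta>) * Gamma \<beta> * Gamma ((\<gamma> + 1) / \<rho>))"
  shows "(\<forall>u\<ge>0.
           g2 u = c * u powr (- \<alpha> - 2) *
             (LBINT v:{0..}. v powr (\<alpha> + \<gamma> + 1) *
                (1 + a * (v / u) powr \<delta>) powr (- ((\<alpha> + 1) / \<delta> + \<beta>)) * exp (- b * v powr \<rho>)) \<and>
           g2 u = c * u powr \<gamma> *
             (LBINT v:{0..}. v powr (\<alpha> + \<gamma> + 1) *
                (1 + a * v powr \<delta>) powr (- ((\<alpha> + 1) / \<delta> + \<beta>)) * exp (- b * (u * v) powr \<rho>)) \<and>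
           (\<forall>\<kappa>. H_separating \<kappa> (1 - (2 + \<alpha>) / \<delta>) (1 / \<delta>) (\<gamma> / \<rho>) (1 / \<rho>) (\<beta> - 1 / \<delta>) (1 / \<delta>) \<longrightarrow>
              complex_of_real (g2 u) = complex_of_real c1 *
                H21_12 \<kappa> (1 - (2 + \<alpha>) / \<delta>) (1 / \<delta>) (\<gamma> / \<rho>) (1 / \<rho>) (\<beta> - 1 / \<delta>) (1 / \<delta>)
                  (b powr (1 / \<rho>) * u / a powr (1 / \<delta>)))) \<and>
         (\<rho> = \<delta> \<longrightarrow>
         (\<forall>\<nu>::nat. \<gamma> - \<delta> * \<beta> + 1 \<noteq> \<delta> * real \<nu> \<and> \<gamma> - \<delta> * \<beta> + 1 \<noteq> - (\<delta> * real \<nu>)) \<longrightarrow>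
         (\<forall>u\<ge>0. \<forall>\<kappa>.
           H_separating \<kappa> (1 - (2 + \<alpha>) / \<delta>) (1 / \<delta>) (\<gamma> / \<delta>) (1 / \<delta>) (\<beta> - 1 / \<delta>) (1 / \<delta>) \<longrightarrow>
           H21_12 \<kappa> (1 - (2 + \<alpha>) / \<delta>) (1 / \<delta>) (\<gamma> / \<delta>) (1 / \<delta>) (\<beta> - 1 / \<delta>) (1 / \<delta>)
               ((b / a) powr (1 / \<delta>) * u) =
             complex_of_real
               (\<delta> * Gamma (\<beta> - (\<gamma> + 1) / \<delta>) * Gamma ((2 + \<alpha> + \<gamma>) / \<delta>) *
                  ((b / a) powr (1 / \<delta>) * u) powr \<gamma> *
                  confluent_1F1 ((2 + \<alpha> + \<gamma>) / \<delta>) (1 + (\<gamma> + 1) / \<delta> - \<beta>) (b / a * u powr \<delta>) +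
                \<delta> * Gamma ((\<gamma> + 1) / \<delta> - \<beta>) * Gamma ((\<alpha> + 1) / \<delta> + \<beta>) *
                  ((b / a) powr (1 / \<delta>) * u) powr (\<beta> * \<delta> - 1) *
                  confluent_1F1 ((\<alpha> + 1) / \<delta> + \<beta>) (1 + \<beta> - (\<gamma> + 1) / \<delta>) (b / a * u powr \<delta>))))"
proof (intro conjI allI impI)
  let ?J = "\<lambda>u. LBINT v:{0..}. v powr (\<alpha> + \<gamma> + 1) *
              (1 + a * v powr \<delta>) powr (- ((\<alpha> + 1) / \<delta> + \<beta>)) * exp (- b * (u * v) powr \<rho>)"
  have g2_eq: "g2 u = c * u powr \<gamma> * ?J u" if u: "u \<ge> 0" for u
  proof -
    have "g2 u = (LBINT v:{0..}. c * u powr \<gamma> * (v powr (\<alpha> + \<gamma> + 1) *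
              (1 + a * v powr \<delta>) powr (- ((\<alpha> + 1) / \<delta> + \<beta>)) * exp (- b * (u * v) powr \<rho>)))"
      unfolding g2 set_lebesgue_integral_def
    proof (intro Bochner_Integration.integral_cong refl)
      fix v :: real
      show "indicator {0..} v *\<^sub>R (v * f1 v * f2 (u * v)) =
              indicator {0..} v *\<^sub>R (c * u powr \<gamma> * (v powr (\<alpha> + \<gamma> + 1) *
              (1 + a * v powr \<delta>) powr (- ((\<alpha> + 1) / \<delta> + \<beta>)) * exp (- b * (u * v) powr \<rho>)))"
      proof (cases "v > 0")
        case True
        have "v powr (\<alpha> + \<gamma> + 1) = v * v powr \<alpha> * v powr \<gamma>"
          using True powr_add[of v "\<alpha> + \<gamma>" 1] powr_add[of v \<alpha> \<gamma>] by simp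
        moreover have "(u * v) powr \<gamma> = u powr \<gamma> * v powr \<gamma>"
          using True u by (simp add: powr_mult)
        ultimately show ?thesis
          using True u by (simp add: f1 f2 c mult_ac)
      qed (auto simp: indicator_def)
    qed
    thus ?thesis by simp
  qed
  have b_split: "b powr ((\<gamma> + 1) / \<rho>) = b powr (\<gamma> / \<rho>) * b powr (1 / \<rho>)"
    by (simp add: add_divide_distrib powr_add)
  have "(2 + \<alpha>) / \<delta> = (\<alpha> + 1) / \<delta> + 1 / \<delta>"
    by (simp flip: add_divide_distrib)
  hence a_split: "a powr ((2 + \<alpha>) / \<delta>) = a powr ((\<alpha> + 1) / \<delta>) * a powr (1 / \<delta>)"
    by (simp only: powr_add)
  fix u :: real
  assume u: "u \<ge> 0"
  show "g2 u = c * u powr \<gamma> * ?J u" by (rule g2_eq) (rule u)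
  show "g2 u = c * u powr (- \<alpha> - 2) *
             (LBINT v:{0..}. v powr (\<alpha> + \<gamma> + 1) *
                (1 + a * (v / u) powr \<delta>) powr (- ((\<alpha> + 1) / \<delta> + \<beta>)) * exp (- b * v powr \<rho>))"
  proof (cases "u = 0")
    case False
    with u have u: "u > 0" by simp
    have "(LBINT v:{0..}. v powr (\<alpha> + \<gamma> + 1) *
                (1 + a * (v / u) powr \<delta>) powr (- ((\<alpha> + 1) / \<delta> + \<beta>)) * exp (- b * v powr \<rho>)) =
          \<bar>u\<bar> *\<^sub>R (LBINT v. indicator {0..} (0 + u * v) *\<^sub>R ((0 + u * v) powr (\<alpha> + \<gamma> + 1) *
                (1 + a * ((0 + u * v) / u) powr \<delta>) powr (- ((\<alpha> + 1) / \<delta> + \<beta>)) * exp (- b * (0 + u * v) powr \<rho>)))"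
      unfolding set_lebesgue_integral_def using u by (intro lborel_integral_real_affine) auto
    also have "\<dots> = u * (LBINT v:{0..}. u powr (\<alpha> + \<gamma> + 1) * (v powr (\<alpha> + \<gamma> + 1) *
              (1 + a * v powr \<delta>) powr (- ((\<alpha> + 1) / \<delta> + \<beta>)) * exp (- b * (u * v) powr \<rho>)))"
      unfolding set_lebesgue_integral_def using u
      by (auto simp: indicator_def zero_le_mult_iff powr_mult intro!: Bochner_Integration.integral_cong)
    also have "\<dots> = u * u powr (\<alpha> + \<gamma> + 1) * ?J u"
      by simp
    finally have "c * u powr (- \<alpha> - 2) * (LBINT v:{0..}. v powr (\<alpha> + \<gamma> + 1) *
                (1 + a * (v / u) powr \<delta>) powr (- ((\<alpha> + 1) / \<delta> + \<beta>)) * exp (- b * v powr \<rho>)) =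
          c * (u powr (- \<alpha> - 2) * (u * u powr (\<alpha> + \<gamma> + 1))) * ?J u"
      by simp
    also have "u powr (- \<alpha> - 2) * (u * u powr (\<alpha> + \<gamma> + 1)) = u powr \<gamma>"
      using u by (simp add: powr_mult_base flip: powr_add)
    finally show ?thesis using g2_eq[of u] u by (simp only: less_imp_le)
  qed (simp add: g2 f2)
  fix \<kappa> :: real
  assume sep: "H_separating \<kappa> (1 - (2 + \<alpha>) / \<delta>) (1 / \<delta>) (\<gamma> / \<rho>) (1 / \<rho>) (\<beta> - 1 / \<delta>) (1 / \<delta>)"
  show "complex_of_real (g2 u) = complex_of_real c1 *
                H21_12 \<kappa> (1 - (2 + \<alpha>) / \<delta>) (1 / \<delta>) (\<gamma> / \<rho>) (1 / \<rho>) (\<beta> - 1 / \<delta>) (1 / \<delta>)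
                  (b powr (1 / \<rho>) * u / a powr (1 / \<delta>))"
  proof (cases "u = 0")
    case False
    with u have u: "u > 0" by simp
    have "c = c1 * (\<delta> * \<rho> * Gamma ((\<alpha> + 1) / \<delta> + \<beta>) * a powr ((2 + \<alpha>) / \<delta>) * b powr (\<gamma> / \<rho>))"
      unfolding c c1 a_split b_split using \<open>a > 0\<close> by simp (simp add: mult_ac)
    hence "g2 u = c1 * (\<delta> * \<rho> * Gamma ((\<alpha> + 1) / \<delta> + \<beta>) * a powr ((2 + \<alpha>) / \<delta>) * b powr (\<gamma> / \<rho>) * u powr \<gamma> * ?J u)"
      using g2_eq[of u] u by (simp only: mult_ac less_imp_le)
    thus ?thesis
      using H21_12_eq_integral[OF \<open>\<delta> > 0\<close> \<open>\<rho> > 0\<close> \<open>a > 0\<close> \<open>b > 0\<close> u sep]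
      by (simp only: of_real_mult)
  qed (simp add: g2 f2 H21_12_zero)
next
  fix u \<kappa> :: real
  assume "\<rho> = \<delta>" and nonres: "\<forall>\<nu>::nat. \<gamma> - \<delta> * \<beta> + 1 \<noteq> \<delta> * real \<nu> \<and> \<gamma> - \<delta> * \<beta> + 1 \<noteq> - (\<delta> * real \<nu>)"
    and u: "u \<ge> 0"
    and sep: "H_separating \<kappa> (1 - (2 + \<alpha>) / \<delta>) (1 / \<delta>) (\<gamma> / \<delta>) (1 / \<delta>) (\<beta> - 1 / \<delta>) (1 / \<delta>)"
  define z where "z = (b / a) powr (1 / \<delta>) * u"
  have nonint: "\<gamma> / \<delta> - (\<beta> - 1 / \<delta>) \<notin> \<int>"
  proof
    assume "\<gamma> / \<delta> - (\<beta> - 1 / \<delta>) \<in> \<int>"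
    then obtain m where "\<gamma> / \<delta> - (\<beta> - 1 / \<delta>) = of_int m" by (auto elim: Ints_cases)
    hence m: "\<gamma> - \<delta> * \<beta> + 1 = \<delta> * of_int m"
      using \<open>\<delta> > 0\<close> by (simp add: field_simps)
    \<comment> \<open>for \<open>m < 0\<close> the second alternative of the hypothesis applies, with \<open>\<nu> = -m\<close>\<close>
    show False
      using nonres[rule_format, of "nat m"] nonres[rule_format, of "nat (- m)"] m
      by (cases "m \<ge> 0") auto
  qed
  show "H21_12 \<kappa> (1 - (2 + \<alpha>) / \<delta>) (1 / \<delta>) (\<gamma> / \<delta>) (1 / \<delta>) (\<beta> - 1 / \<delta>) (1 / \<delta>)
               ((b / a) powr (1 / \<delta>) * u) =
             complex_of_real
               (\<delta> * Gamma (\<beta> - (\<gamma> + 1) / \<delta>) * Gamma ((2 + \<alpha> + \<gamma>) / \<delta>) *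
                  ((b / a) powr (1 / \<delta>) * u) powr \<gamma> *
                  confluent_1F1 ((2 + \<alpha> + \<gamma>) / \<delta>) (1 + (\<gamma> + 1) / \<delta> - \<beta>) (b / a * u powr \<delta>) +
                \<delta> * Gamma ((\<gamma> + 1) / \<delta> - \<beta>) * Gamma ((\<alpha> + 1) / \<delta> + \<beta>) *
                  ((b / a) powr (1 / \<delta>) * u) powr (\<beta> * \<delta> - 1) *
                  confluent_1F1 ((\<alpha> + 1) / \<delta> + \<beta>) (1 + \<beta> - (\<gamma> + 1) / \<delta>) (b / a * u powr \<delta>))"
  proof (cases "u = 0")
    case False
    with u have u: "u > 0" by simp
    have z: "z > 0" using u \<open>a > 0\<close> \<open>b > 0\<close> by (simp add: z_def)
    have z\<delta>: "z powr \<delta> = b / a * u powr \<delta>"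
      using u \<open>a > 0\<close> \<open>b > 0\<close> \<open>\<delta> > 0\<close> by (simp add: z_def powr_mult powr_powr)
    have args: "\<beta> - 1 / \<delta> - \<gamma> / \<delta> = \<beta> - (\<gamma> + 1) / \<delta>" "\<gamma> / \<delta> - (\<beta> - 1 / \<delta>) = (\<gamma> + 1) / \<delta> - \<beta>"
      "1 - (1 - (2 + \<alpha>) / \<delta>) + \<gamma> / \<delta> = (2 + \<alpha> + \<gamma>) / \<delta>"
      "1 - (1 - (2 + \<alpha>) / \<delta>) + (\<beta> - 1 / \<delta>) = (\<alpha> + 1) / \<delta> + \<beta>"
      "1 + \<gamma> / \<delta> - (\<beta> - 1 / \<delta>) = 1 + (\<gamma> + 1) / \<delta> - \<beta>"
      "1 + (\<beta> - 1 / \<delta>) - \<gamma> / \<delta> = 1 + \<beta> - (\<gamma> + 1) / \<delta>"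
      "\<gamma> / \<delta> / (1 / \<delta>) = \<gamma>" "(\<beta> - 1 / \<delta>) / (1 / \<delta>) = \<beta> * \<delta> - 1" "1 / (1 / \<delta>) = \<delta>"
      using \<open>\<delta> > 0\<close> by (simp_all add: field_simps)
    show ?thesis
      using H21_12_eq_1F1[OF _ z sep nonint, unfolded args z\<delta>] \<open>\<delta> > 0\<close>
      unfolding z_def by (simp add: distrib_left mult_ac)
  qed (simp add: H21_12_zero)
qed

end
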